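(* Let $\Omega\subset\mathbb{R}^d$, $d\in\{2,3\}$, be a bounded convex domain with polygonal or polyhedral boundary, let $f\in H^{-1}(\Omega)$, let $u\in H^1_0(\Omega)$ be the minimiser over $v\in H^1_0(\Omega)$ of $\frac12\int_\Omega|\nabla v|^2\,dx-\ell(v)$, and let $\boldsymbol\sigma=\nabla u$. Let $k\ge 0$, let $\mathcal{T}_h$ be a quasi-uniform partition of $\Omega$ with mesh-size $h$, and let $V_h$, $\mathbf{V}_h=[V_h]^d$ and $\mathbf{Q}_h$ be the finite element spaces on $\mathcal{T}_h$ defined in the context. Let $\mathbf{W}_h$ be either $\mathbf{Q}_h$ or $\mathbf{V}_h$. Then there is a unique $(u_h,\boldsymbol\sigma_h)\in V_h\times\mathbf{W}_h$ such that $$a((u_h,\boldsymbol\sigma_h),(v_h,\boldsymbol\tau_h))=2\,\ell(v_h)\qquad\text{for all }(v_h,\boldsymbol\tau_h)\in V_h\times\mathbf{W}_h,$$ and it satisfies $$\|u-u_h\|_{1,\Omega}+\|\boldsymbol\sigma-\boldsymbol\sigma_h\|_{0,\Omega}\le c\left(\inf_{v_h\in V_h}\|u-v_h\|_{1,\Omega}+\inf_{\boldsymbol\tau_h\in\mathbf{W}_h}\|\boldsymbol\sigma-\boldsymbol\tau_h\|_{0,\Omega}\right),$$ where $c>0$ is a constant independent of the partition $\mathcal{T}_h$ (in particular of $h$) and of $f$ (hence of $u$).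
   Context: Norms: $\|\cdot\|_{0,\Omega}$ is the $L^2(\Omega)$ norm (also for vector-valued functions), with inner product $(\cdot,\cdot)_{0,\Omega}$, and $\|\cdot\|_{1,\Omega}$ is the $H^1(\Omega)$ norm. For $f\in H^{-1}(\Omega)$, $\ell(v)=\int_\Omega f\,v\,dx$ on $H^1_0(\Omega)$, understood as a duality pairing. Bilinear form: for $u,v\in H^1_0(\Omega)$ and $\boldsymbol\sigma,\boldsymbol\tau\in[L^2(\Omega)]^d$, $$a((u,\boldsymbol\sigma),(v,\boldsymbol\tau))=(\boldsymbol\sigma,\boldsymbol\tau)_{0,\Omega}+(\boldsymbol\sigma-2\nabla u,\ \boldsymbol\tau-2\nabla v)_{0,\Omega}.$$ Finite element spaces: $\mathcal{T}_h$ is a quasi-uniform partition of $\Omega$ into simplices, convex quadrilaterals or hexahedra. The reference element $\hat T$ is either the reference simplex $\{\mathbf{x}\in\mathbb{R}^d: x_i>0,\ i=1,\dots,d,\ \sum_{i=1}^d x_i<1\}$ or the square/cube $(0,1)^d$, and each $T\in\mathcal{T}_h$ is the image of $\hat T$ under an affine map $F_T$. For $k\ge0$, $\mathcal{Q}_k(\hat T)$ is the space of polynomials of total degree at most $k$ if $\hat T$ is the reference simplex, and of polynomials of degree at most $k$ in each variable if $\hat T$ is the reference square or cube; $\mathcal{Q}_k(T)$ denotes the analogous polynomial space on $T$. Set $$S_h=\{v_h\in H^1(\Omega): v_h|_T=\hat v_h\circ F_T^{-1},\ \hat v_h\in\mathcal{Q}_k(\hat T),\ T\in\mathcal{T}_h\},\qquad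 V_h=S_h\cap H^1_0(\Omega),\qquad \mathbf{V}_h=[V_h]^d,$$ $$L_h=\{v_h\in L^2(\Omega): v_h|_T\in\mathcal{Q}_k(T),\ T\in\mathcal{T}_h\},\qquad \mathbf{Q}_h=[L_h]^d.$$ *)

theory Defs
  imports "HOL-Analysis.Analysis"
begin

text \<open>
  Elements of $L^2(\Omega)$ and of the Sobolev spaces are represented by functions on the whole
  space; values outside $\Omega$ are irrelevant, and two representatives denote the same element
  iff they agree almost everywhere in $\Omega$.
\<close>

definition polyhedral_convex_domain :: "('a::euclidean_space) set \<Rightarrow> bool" where
  "polyhedral_convex_domain \<Omega> \<longleftrightarrow>
     open \<Omega> \<and> \<Omega> \<noteq> {} \<and> bounded \<Omega> \<and> convex \<Omega> \<and> polytope (closure \<Omega>)"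

subsection \<open>Lebesgue and Sobolev spaces\<close>

definition L2_space :: "('a::euclidean_space) set \<Rightarrow> ('a \<Rightarrow> 'b::euclidean_space) set" where
  "L2_space \<Omega> = {v \<in> borel_measurable (lebesgue_on \<Omega>).
                    integrable (lebesgue_on \<Omega>) (\<lambda>x. (norm (v x))\<^sup>2)}"

definition L2_inner ::
  "('a::euclidean_space) set \<Rightarrow> ('a \<Rightarrow> 'b::euclidean_space) \<Rightarrow> ('a \<Rightarrow> 'b) \<Rightarrow> real" where
  "L2_inner \<Omega> v w = (LINT x|lebesgue_on \<Omega>. v x \<bullet> w x)"

definition norm_L2 :: "('a::euclidean_space) set \<Rightarrow> ('a \<Rightarrow> 'b::euclidean_space) \<Rightarrow> real" where
  "norm_L2 \<Omega> v = sqrt (L2_inner \<Omega> v v)"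

definition partial :: "('a::euclidean_space \<Rightarrow> real) \<Rightarrow> 'a \<Rightarrow> 'a \<Rightarrow> real" where
  "partial \<phi> e x = frechet_derivative \<phi> (at x) e"

primrec Ck :: "nat \<Rightarrow> ('a::euclidean_space \<Rightarrow> real) \<Rightarrow> bool" where
  "Ck 0 \<phi> \<longleftrightarrow> continuous_on UNIV \<phi>"
| "Ck (Suc m) \<phi> \<longleftrightarrow> (\<forall>x. \<phi> differentiable (at x)) \<and> (\<forall>e\<in>Basis. Ck m (partial \<phi> e))"

definition test_functions :: "('a::euclidean_space) set \<Rightarrow> ('a \<Rightarrow> real) set" where
  "test_functions \<Omega> =
     {\<phi>. (\<forall>m. Ck m \<phi>) \<and> compact (closure {x. \<phi> x \<noteq> 0}) \<and> closure {x. \<phi> x \<noteq> 0} \<subseteq> \<Omega>}"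

definition has_weak_gradient ::
  "('a::euclidean_space) set \<Rightarrow> ('a \<Rightarrow> real) \<Rightarrow> ('a \<Rightarrow> 'a) \<Rightarrow> bool" where
  "has_weak_gradient \<Omega> v g \<longleftrightarrow> g \<in> L2_space \<Omega> \<and>
     (\<forall>\<phi>\<in>test_functions \<Omega>. \<forall>e\<in>Basis.
        (LINT x|lebesgue_on \<Omega>. v x * partial \<phi> e x) =
        - (LINT x|lebesgue_on \<Omega>. (g x \<bullet> e) * \<phi> x))"

definition H1_space :: "('a::euclidean_space) set \<Rightarrow> ('a \<Rightarrow> real) set" where
  "H1_space \<Omega> = {v \<in> L2_space \<Omega>. \<exists>g. has_weak_gradient \<Omega> v g}"

text \<open>The weak gradient is determined almost everywhere in an open \<open>\<Omega>\<close>; the choice below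
  picks a representative.\<close>

definition weak_grad :: "('a::euclidean_space) set \<Rightarrow> ('a \<Rightarrow> real) \<Rightarrow> 'a \<Rightarrow> 'a" where
  "weak_grad \<Omega> v = (SOME g. has_weak_gradient \<Omega> v g)"

definition norm_H1 :: "('a::euclidean_space) set \<Rightarrow> ('a \<Rightarrow> real) \<Rightarrow> real" where
  "norm_H1 \<Omega> v = sqrt ((norm_L2 \<Omega> v)\<^sup>2 + (norm_L2 \<Omega> (weak_grad \<Omega> v))\<^sup>2)"

definition H10_space :: "('a::euclidean_space) set \<Rightarrow> ('a \<Rightarrow> real) set" where
  "H10_space \<Omega> = {v \<in> H1_space \<Omega>.
     \<forall>\<epsilon>>0. \<exists>\<phi>\<in>test_functions \<Omega>. norm_H1 \<Omega> (\<lambda>x. v x - \<phi> x) < \<epsilon>}"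

text \<open>An element \<open>f\<close> of $H^{-1}(\Omega)$ is identified with the functional \<open>ell\<close> it induces on
  $H^1_0(\Omega)$. Linearity and boundedness force \<open>ell\<close> to respect equality almost everywhere.\<close>

definition H_minus1 :: "('a::euclidean_space) set \<Rightarrow> (('a \<Rightarrow> real) \<Rightarrow> real) set" where
  "H_minus1 \<Omega> = {ell.
     (\<forall>v\<in>H10_space \<Omega>. \<forall>w\<in>H10_space \<Omega>. \<forall>a b.
        ell (\<lambda>x. a * v x + b * w x) = a * ell v + b * ell w) \<and>
     (\<exists>C. \<forall>v\<in>H10_space \<Omega>. \<bar>ell v\<bar> \<le> C * norm_H1 \<Omega> v)}"

definition energy ::
  "('a::euclidean_space) set \<Rightarrow> (('a \<Rightarrow> real) \<Rightarrow> real) \<Rightarrow> ('a \<Rightarrow> real) \<Rightarrow> real" where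
  "energy \<Omega> ell v = 1/2 * (LINT x|lebesgue_on \<Omega>. (norm (weak_grad \<Omega> v x))\<^sup>2) - ell v"

fun bilinear_a ::
  "('a::euclidean_space) set \<Rightarrow> ('a \<Rightarrow> real) \<times> ('a \<Rightarrow> 'a) \<Rightarrow> ('a \<Rightarrow> real) \<times> ('a \<Rightarrow> 'a) \<Rightarrow> real" where
  "bilinear_a \<Omega> (u, \<sigma>) (v, \<tau>) =
     L2_inner \<Omega> \<sigma> \<tau> +
     L2_inner \<Omega> (\<lambda>x. \<sigma> x - 2 *\<^sub>R weak_grad \<Omega> u x) (\<lambda>x. \<tau> x - 2 *\<^sub>R weak_grad \<Omega> v x)"

subsection \<open>Partitions and finite element spaces\<close>

datatype element_kind = Simplex | Cube

fun ref_element :: "element_kind \<Rightarrow> (real ^ 'n) set" where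
  "ref_element Simplex = {x. (\<forall>i. 0 < x $ i) \<and> (\<Sum>i\<in>UNIV. x $ i) < 1}"
| "ref_element Cube = {x. \<forall>i. 0 < x $ i \<and> x $ i < 1}"

fun exponents :: "element_kind \<Rightarrow> nat \<Rightarrow> ('n::finite \<Rightarrow> nat) set" where
  "exponents Simplex k = {\<alpha>. (\<Sum>i\<in>UNIV. \<alpha> i) \<le> k}"
| "exponents Cube k = {\<alpha>. \<forall>i. \<alpha> i \<le> k}"

definition poly_space :: "element_kind \<Rightarrow> nat \<Rightarrow> (real ^ 'n \<Rightarrow> real) set" where
  "poly_space K k =
     {p. \<exists>c. p = (\<lambda>x. \<Sum>\<alpha>\<in>exponents K k. c \<alpha> * (\<Prod>i\<in>UNIV. (x $ i) ^ \<alpha> i))}"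

text \<open>The elements are open, so they cover \<open>\<Omega>\<close> only up to their boundaries. The affine maps
  \<open>F T\<close> from the reference element are part of the data; no matching condition on common faces
  is imposed.\<close>

definition affine_partition ::
  "(real ^ 'n) set \<Rightarrow> element_kind \<Rightarrow> (real ^ 'n) set set
     \<Rightarrow> ((real ^ 'n) set \<Rightarrow> real ^ 'n \<Rightarrow> real ^ 'n) \<Rightarrow> bool" where
  "affine_partition \<Omega> K \<T> F \<longleftrightarrow>
     finite \<T> \<and> disjoint \<T> \<and> (\<Union>T\<in>\<T>. closure T) = closure \<Omega> \<and>
     (\<forall>T\<in>\<T>. (\<exists>A b. invertible A \<and> F T = (\<lambda>x. A *v x + b)) \<and> T = F T ` ref_element K)"

definition mesh_size :: "(real ^ 'n) set set \<Rightarrow> real" where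
  "mesh_size \<T> = Max (diameter ` \<T>)"

text \<open>Quasi-uniformity (including shape regularity) with constant \<open>\<rho>\<close>: every element contains
  a ball whose radius is at least \<open>\<rho>\<close> times the mesh size.\<close>

definition quasi_uniform :: "real \<Rightarrow> (real ^ 'n) set set \<Rightarrow> bool" where
  "quasi_uniform \<rho> \<T> \<longleftrightarrow> 0 < \<rho> \<and> (\<forall>T\<in>\<T>. \<exists>x. ball x (\<rho> * mesh_size \<T>) \<subseteq> T)"

definition S_h ::
  "(real ^ 'n) set \<Rightarrow> element_kind \<Rightarrow> (real ^ 'n) set set
     \<Rightarrow> ((real ^ 'n) set \<Rightarrow> real ^ 'n \<Rightarrow> real ^ 'n) \<Rightarrow> nat \<Rightarrow> (real ^ 'n \<Rightarrow> real) set" where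
  "S_h \<Omega> K \<T> F k = {v \<in> H1_space \<Omega>.
     \<forall>T\<in>\<T>. \<exists>p\<in>poly_space K k. AE x in lebesgue_on T. v x = p (inv (F T) x)}"

definition V_h ::
  "(real ^ 'n) set \<Rightarrow> element_kind \<Rightarrow> (real ^ 'n) set set
     \<Rightarrow> ((real ^ 'n) set \<Rightarrow> real ^ 'n \<Rightarrow> real ^ 'n) \<Rightarrow> nat \<Rightarrow> (real ^ 'n \<Rightarrow> real) set" where
  "V_h \<Omega> K \<T> F k = S_h \<Omega> K \<T> F k \<inter> H10_space \<Omega>"

text \<open>In contrast to \<open>S_h\<close>, the polynomials here are in the physical variables, also when the
  element is an affine image of the cube.\<close>

definition L_h ::
  "(real ^ 'n) set \<Rightarrow> element_kind \<Rightarrow> (real ^ 'n) set set \<Rightarrow> nat \<Rightarrow> (real ^ 'n \<Rightarrow> real) set" where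
  "L_h \<Omega> K \<T> k = {v \<in> L2_space \<Omega>.
     \<forall>T\<in>\<T>. \<exists>p\<in>poly_space K k. AE x in lebesgue_on T. v x = p x}"

definition vector_valued :: "(real ^ 'n \<Rightarrow> real) set \<Rightarrow> (real ^ 'n \<Rightarrow> real ^ 'n) set" where
  "vector_valued X = {\<tau>. \<forall>i. (\<lambda>x. \<tau> x $ i) \<in> X}"

definition discrete_solution ::
  "(real ^ 'n) set \<Rightarrow> ((real ^ 'n \<Rightarrow> real) \<Rightarrow> real) \<Rightarrow> (real ^ 'n \<Rightarrow> real) set
     \<Rightarrow> (real ^ 'n \<Rightarrow> real ^ 'n) set \<Rightarrow> (real ^ 'n \<Rightarrow> real) \<Rightarrow> (real ^ 'n \<Rightarrow> real ^ 'n) \<Rightarrow> bool" where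
  "discrete_solution \<Omega> ell V W u\<^sub>h \<sigma>\<^sub>h \<longleftrightarrow> u\<^sub>h \<in> V \<and> \<sigma>\<^sub>h \<in> W \<and>
     (\<forall>v\<in>V. \<forall>\<tau>\<in>W. bilinear_a \<Omega> (u\<^sub>h, \<sigma>\<^sub>h) (v, \<tau>) = 2 * ell v)"

end

theory Submission
  imports Defs "HOL-Library.Function_Algebras"
begin

text \<open>
  The form \<open>a\<close> is symmetric, and $a((v,\tau),(v,\tau)) = \|\tau\|^2 + \|\tau - 2\nabla v\|^2$
  controls both $\|\tau\|$ and $\|\nabla v\|$, so by the Poincare inequality it is coercive on
  $H^1_0 \times L^2$. The Euler-Lagrange equation of the minimiser gives
  $a((u,\sigma),(v,\tau)) = 2\,\ell(v)$ for \<open>\<sigma> = \<nabla>u\<close>. Hence the discrete solutions are exactly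
  the \<open>a\<close>-orthogonal projections of \<open>(u, \<sigma>)\<close> onto the finite-dimensional space \<open>V \<times> W\<close>, and the
  best-approximation property of the projection is the error estimate. The constant only depends
  on the radius of a ball around the origin that contains \<open>\<Omega>\<close>.
\<close>

subsection \<open>Projections in semi-inner product spaces\<close>

text \<open>Functions that agree almost everywhere are not identified, and this shapes the whole
  argument. On functions \<open>bilinear_a\<close> is only positive semidefinite, and
  \<open>V_h\<close> and \<open>L_h\<close> contain every modification of their members on null
  sets, so they are not finite-dimensional. Projections are therefore built for semi-inner products,
  onto spaces that are finitely generated up to null functions, and uniqueness is almost everywhere.
  Moreover \<open>weak_grad\<close> is an arbitrary choice, hence linear only almost everywhere.
  Seeing even that much takes uniqueness of weak gradients, that is, the fundamental lemma, for
  which enough smooth cut-off functions have to be constructed. The form is coercive on all pairs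
  because 2\<nabla>v = \<tau> - (\<tau> - 2\<nabla>v) is a difference of the two quantities that it
  measures; subspaces inherit this, so \<open>V\<close> and \<open>W\<close> need no compatibility
  with each other. In the constant \<open>4 * (R + 1)\<close>, the factor \<open>2 * (R + 1)\<close>
  comes from this lower bound and the Poincare constant \<open>2 * R\<close>, the remaining 2 from
  the upper bound of the energy norm.\<close>

instantiation "fun" :: (type, scaleR) scaleR
begin
definition scaleR_fun :: "real \<Rightarrow> ('a \<Rightarrow> 'b) \<Rightarrow> 'a \<Rightarrow> 'b"
  where "scaleR_fun c f = (\<lambda>x. c *\<^sub>R f x)"
instance ..
end

lemma scaleR_fun_apply [simp]: "(c *\<^sub>R f) x = c *\<^sub>R f x"
  by (simp add: scaleR_fun_def)

instance "fun" :: (type, real_vector) real_vector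
  by standard (auto simp: fun_eq_iff algebra_simps)

text \<open>A carrier \<open>E\<close> is used because square integrable functions form only a
  subspace of the type of all functions. Definiteness is left out: a function vanishing almost
  everywhere has length zero without being \<open>0\<close>.\<close>

locale semi_inner =
  fixes E :: "'v::real_vector set" and B :: "'v \<Rightarrow> 'v \<Rightarrow> real"
  assumes sub: "subspace E"
    and sym: "\<lbrakk>x \<in> E; y \<in> E\<rbrakk> \<Longrightarrow> B x y = B y x"
    and add_left: "\<lbrakk>x \<in> E; y \<in> E; z \<in> E\<rbrakk> \<Longrightarrow> B (x + y) z = B x z + B y z"
    and scale_left: "\<lbrakk>x \<in> E; y \<in> E\<rbrakk> \<Longrightarrow> B (c *\<^sub>R x) y = c * B x y"
    and nonneg: "x \<in> E \<Longrightarrow> 0 \<le> B x x"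
begin

lemmas mem = subspace_add[OF sub] subspace_diff[OF sub] subspace_scale[OF sub] subspace_0[OF sub]

lemma add_right: "\<lbrakk>x \<in> E; y \<in> E; z \<in> E\<rbrakk> \<Longrightarrow> B z (x + y) = B z x + B z y"
  using add_left sym mem(1) by metis

lemma scale_right: "\<lbrakk>x \<in> E; y \<in> E\<rbrakk> \<Longrightarrow> B x (c *\<^sub>R y) = c * B x y"
  using scale_left sym mem(3) by metis

lemma diff_left: "\<lbrakk>x \<in> E; y \<in> E; z \<in> E\<rbrakk> \<Longrightarrow> B (x - y) z = B x z - B y z"
  using add_left[of x "(-1) *\<^sub>R y" z] scale_left[of y z "-1"] mem(3)[of y "-1"] by simp

lemma diff_right: "\<lbrakk>x \<in> E; y \<in> E; z \<in> E\<rbrakk> \<Longrightarrow> B z (x - y) = B z x - B z y"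
  using diff_left sym mem(2) by metis

lemmas bilin = add_left add_right scale_left scale_right diff_left diff_right

lemma expand: "\<lbrakk>x \<in> E; y \<in> E\<rbrakk> \<Longrightarrow> B (x + t *\<^sub>R y) (x + t *\<^sub>R y) = B x x + 2 * t * B x y + t\<^sup>2 * B y y"
  by (simp add: bilin mem sym[of y x] algebra_simps power2_eq_square)

lemma Cauchy_Schwarz:
  assumes "x \<in> E" "y \<in> E"
  shows "(B x y)\<^sup>2 \<le> B x x * B y y"
proof (cases "B y y = 0")
  case True
  have "B x y = 0"
  proof (rule ccontr)
    assume n: "B x y \<noteq> 0"
    \<comment> \<open>For \<open>B y y = 0\<close> the squared length of
      \<open>x + t *\<^sub>R y\<close> is affine in \<open>t\<close>; here it takes the value
      -1.\<close>
    define t where "t = - (B x x + 1) / (2 * B x y)"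
    have "0 \<le> B x x + 2 * t * B x y"
      using nonneg[OF mem(1)[OF assms(1) mem(3)[OF assms(2), of t]]] True
      by (simp add: expand[OF assms])
    also have "\<dots> = - 1" using n by (simp add: t_def field_simps)
    finally show False by simp
  qed
  then show ?thesis using True by simp
next
  case False
  then have pos: "B y y > 0" using nonneg[OF assms(2)] by linarith
  \<comment> \<open>The quadratic in \<open>t\<close> is evaluated at its minimiser.\<close>
  have "0 \<le> B x x + 2 * (- B x y / B y y) * B x y + (- B x y / B y y)\<^sup>2 * B y y"
    using nonneg[OF mem(1)[OF assms(1) mem(3)[OF assms(2), of "- B x y / B y y"]]]
    unfolding expand[OF assms] .
  also have "\<dots> = B x x - (B x y)\<^sup>2 / B y y"
    using False by (simp add: field_simps power2_eq_square)
  finally show ?thesis using pos by (simp add: field_simps)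
qed

text \<open>This replaces definiteness at the point where an orthogonalisation would divide by
  zero.\<close>

lemma null_left: "\<lbrakk>x \<in> E; y \<in> E; B x x = 0\<rbrakk> \<Longrightarrow> B x y = 0"
  using Cauchy_Schwarz[of x y] by simp

lemma le_sqrt: "\<lbrakk>x \<in> E; y \<in> E\<rbrakk> \<Longrightarrow> \<bar>B x y\<bar> \<le> sqrt (B x x) * sqrt (B y y)"
  using real_sqrt_le_mono[OF Cauchy_Schwarz[of x y]] by (simp add: real_sqrt_mult)

lemma triangle:
  assumes "x \<in> E" "y \<in> E"
  shows "sqrt (B (x + y) (x + y)) \<le> sqrt (B x x) + sqrt (B y y)"
proof (rule real_le_lsqrt)
  show "0 \<le> sqrt (B x x) + sqrt (B y y)" using nonneg assms by simp
  have "B (x + y) (x + y) = B x x + 2 * B x y + B y y"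
    using expand[OF assms, of 1] by simp
  then show "B (x + y) (x + y) \<le> (sqrt (B x x) + sqrt (B y y))\<^sup>2"
    using le_sqrt[OF assms] nonneg assms by (simp add: power2_sum)
qed

lemma norm_scale: "x \<in> E \<Longrightarrow> sqrt (B (c *\<^sub>R x) (c *\<^sub>R x)) = \<bar>c\<bar> * sqrt (B x x)"
  by (simp add: bilin mem real_sqrt_mult flip: mult.assoc)

text \<open>\<open>Z\<close> plays the role of the functions vanishing almost everywhere, \<open>S\<close> of a finite generating
  set, whose elements need not belong to \<open>E\<close>.\<close>

lemma exists_projection:
  assumes "finite S" "subspace X" "X \<subseteq> E" "subspace Z"
    and "\<And>x. x \<in> X \<Longrightarrow> x \<in> Z \<Longrightarrow> B x x = 0"
    and "X \<subseteq> {s + n |s n. s \<in> span S \<and> n \<in> Z}" "z \<in> E"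
  shows "\<exists>p\<in>X. \<forall>x\<in>X. B (z - p) x = 0"
  using assms
proof (induction S arbitrary: X z rule: finite_induct)
  case empty
  \<comment> \<open>Without generators every member of \<open>X\<close> lies in \<open>Z\<close> and
    is null, so \<open>0\<close> is a projection.\<close>
  have "B z x = 0" if "x \<in> X" for x
    using empty that null_left[of x z] sym[of x z] by fastforce
  then show ?case using subspace_0[OF empty.prems(1)] by (metis diff_zero)
next
  case (insert b S)
  define G where "G = {s + n |s n. s \<in> span S \<and> n \<in> Z}"
  \<comment> \<open>The members of \<open>X\<close> that do without \<open>b\<close>. Either
    \<open>X'\<close> is all of \<open>X\<close>, or a single \<open>y\<close> complements
    it.\<close>
  define X' where "X' = X \<inter> G"
  have subG: "subspace G"
    unfolding G_def using subspace_sums[OF subspace_span insert.prems(3)] .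
  have subX': "subspace X'" unfolding X'_def
    by (simp add: insert.prems subG subspace_inter)
  have "\<exists>p\<in>X'. \<forall>x\<in>X'. B (z - p) x = 0" if "z \<in> E" for z
  proof (rule insert.IH[OF subX' _ insert.prems(3)])
    show "X' \<subseteq> E" using insert.prems(2) by (auto simp: X'_def)
    show "X' \<subseteq> {s + n |s n. s \<in> span S \<and> n \<in> Z}" by (auto simp: X'_def G_def)
    show "B x x = 0" if "x \<in> X'" "x \<in> Z" for x
      using that insert.prems(4) by (auto simp: X'_def)
  qed (rule that)
  then obtain P where P: "\<And>z. z \<in> E \<Longrightarrow> P z \<in> X' \<and> (\<forall>x\<in>X'. B (z - P z) x = 0)"
    by metis
  show ?case
  proof (cases "X = X'")
    case True
    then show ?thesis using P[OF insert.prems(6)] by auto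
  next
    case False
    then obtain y where y: "y \<in> X" "y \<notin> G" by (auto simp: X'_def)
    have dec: "\<exists>k. x - k *\<^sub>R b \<in> G" if x: "x \<in> X" for x
    proof -
      obtain s n where sn: "s \<in> span (insert b S)" "n \<in> Z" "x = s + n"
        using x insert.prems(5) by blast
      then obtain k where "s - k *\<^sub>R b \<in> span S" by (meson span_breakdown_eq)
      then have "(s - k *\<^sub>R b) + n \<in> G" using sn by (auto simp: G_def)
      moreover have "(s - k *\<^sub>R b) + n = x - k *\<^sub>R b" using sn by simp
      ultimately show ?thesis by metis
    qed
    obtain k where k: "y - k *\<^sub>R b \<in> G" using dec y by blast
    have k0: "k \<noteq> 0" using k y by auto
    \<comment> \<open>Modulo \<open>G\<close>, both \<open>x\<close> and \<open>y\<close> are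
      multiples of \<open>b\<close>, and the one for \<open>y\<close> is not zero. So
      \<open>b\<close>, which may lie outside \<open>X\<close>, can be eliminated by means of
      \<open>y\<close>, which lies in \<open>X\<close>.\<close>
    have dec': "\<exists>t. x - t *\<^sub>R y \<in> X'" if x: "x \<in> X" for x
    proof -
      obtain l where l: "x - l *\<^sub>R b \<in> G" using dec x by blast
      have "x - (l / k) *\<^sub>R y = (x - l *\<^sub>R b) - (l / k) *\<^sub>R (y - k *\<^sub>R b)"
        using k0 by (simp add: algebra_simps)
      also have "\<dots> \<in> G" by (intro subspace_diff[OF subG] subspace_scale[OF subG] l k)
      finally show ?thesis unfolding X'_def
        using x y subspace_diff[OF insert.prems(1)] subspace_scale[OF insert.prems(1)] by blast
    qed
    have XE: "x \<in> E" if "x \<in> X" for x using that insert.prems by auto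
    have X'X: "x \<in> X" if "x \<in> X'" for x using that by (auto simp: X'_def)
    \<comment> \<open>Gram-Schmidt: \<open>w\<close> is the part of \<open>y\<close> orthogonal to
      \<open>X'\<close>, so the projection onto \<open>X\<close> only adds a component along
      \<open>w\<close>.\<close>
    define w where "w = y - P y"
    have Py: "P y \<in> X'" "\<And>x. x \<in> X' \<Longrightarrow> B w x = 0"
      using P[OF XE[OF y(1)]] by (auto simp: w_def)
    have wX: "w \<in> X" unfolding w_def
      using y Py X'X subspace_diff[OF insert.prems(1)] by auto
    define q where "q = P z + (B z w / B w w) *\<^sub>R w"
    have Pz: "P z \<in> X'" "\<And>x. x \<in> X' \<Longrightarrow> B (z - P z) x = 0" using P[OF insert.prems(6)] by auto
    have qX: "q \<in> X" unfolding q_def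
      using Pz X'X wX subspace_add[OF insert.prems(1)] subspace_scale[OF insert.prems(1)] by auto
    \<comment> \<open>If \<open>w\<close> is null, the coefficient in \<open>q\<close> is 0 by
      division by zero, and orthogonality to \<open>w\<close> comes from
      \<open>null_left\<close>.\<close>
    have Bw: "B (z - q) w = 0"
    proof (cases "B w w = 0")
      case True
      have "B w (z - q) = 0"
        by (rule null_left) (use True XE wX qX insert.prems mem in auto)
      then show ?thesis using sym XE wX qX insert.prems mem by metis
    next
      case False
      have "B (P z) w = 0" using Py(2)[OF Pz(1)] sym XE X'X wX Pz by metis
      then show ?thesis unfolding q_def
        using False insert.prems XE wX X'X Pz by (simp add: bilin mem)
    qed
    have Bx': "B (z - q) x = 0" if "x \<in> X'" for x
      using Pz(2)[OF that] Py(2)[OF that] insert.prems XE wX X'X[OF that] X'X[OF Pz(1)]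
      unfolding q_def by (simp add: bilin mem)
    have "B (z - q) x = 0" if x: "x \<in> X" for x
    proof -
      obtain t where t: "x - t *\<^sub>R y \<in> X'" using dec'[OF x] by blast
      have "x = (x - t *\<^sub>R y) + t *\<^sub>R w + t *\<^sub>R P y" by (simp add: w_def algebra_simps)
      moreover have "B (z - q) ((x - t *\<^sub>R y) + t *\<^sub>R w + t *\<^sub>R P y) = 0"
        using Bx'[OF t] Bw Bx'[OF Py(1)] XE[OF X'X[OF t]] XE[OF wX] XE[OF X'X[OF Py(1)]] XE[OF qX] insert.prems(6)
        by (simp only: add_right scale_right mem)
      ultimately show ?thesis by metis
    qed
    then show ?thesis using qX by blast
  qed
qed

text \<open>Pythagoras: \<open>z - x\<close> splits into \<open>z - p\<close> and
  \<open>p - x\<close>, and the latter lies in \<open>X\<close>.\<close>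

lemma projection_best:
  assumes "z \<in> E" "subspace X" "X \<subseteq> E" "p \<in> X" "\<And>x. x \<in> X \<Longrightarrow> B (z - p) x = 0" "x \<in> X"
  shows "B (z - p) (z - p) \<le> B (z - x) (z - x)"
proof -
  have px: "p - x \<in> X" using assms by (simp add: subspace_diff)
  have E: "z - p \<in> E" "p - x \<in> E" using assms px by (auto simp: mem)
  have "B (z - x) (z - x) = B (z - p) (z - p) + 2 * B (z - p) (p - x) + B (p - x) (p - x)"
    using expand[OF E, of 1] by simp
  then show ?thesis using assms(5)[OF px] nonneg[OF E(2)] by simp
qed

end

subsection \<open>The space of square integrable functions\<close>

lemma L2_spaceD:
  assumes "v \<in> L2_space \<Omega>"
  shows "v \<in> borel_measurable (lebesgue_on \<Omega>)" "integrable (lebesgue_on \<Omega>) (\<lambda>x. (norm (v x))\<^sup>2)"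
  using assms by (auto simp: L2_space_def)

lemma integrable_L2_inner:
  assumes "v \<in> L2_space \<Omega>" "w \<in> L2_space \<Omega>"
  shows "integrable (lebesgue_on \<Omega>) (\<lambda>x. v x \<bullet> w x)"
proof (rule Bochner_Integration.integrable_bound)
  show "integrable (lebesgue_on \<Omega>) (\<lambda>x. (norm (v x))\<^sup>2 + (norm (w x))\<^sup>2)"
    using assms L2_spaceD by (intro Bochner_Integration.integrable_add) auto
  show "(\<lambda>x. v x \<bullet> w x) \<in> borel_measurable (lebesgue_on \<Omega>)"
    using assms[THEN L2_spaceD(1)] by measurable
  have "\<bar>a \<bullet> b\<bar> \<le> (norm a)\<^sup>2 + (norm b)\<^sup>2" for a b :: 'b
  proof -
    have "\<bar>a \<bullet> b\<bar> \<le> norm a * norm b" by (rule Cauchy_Schwarz_ineq2)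
    also have "2 * (norm a * norm b) \<le> (norm a)\<^sup>2 + (norm b)\<^sup>2"
      using sum_squares_bound[of "norm a" "norm b"] by simp
    then have "norm a * norm b \<le> (norm a)\<^sup>2 + (norm b)\<^sup>2"
      using mult_nonneg_nonneg[OF norm_ge_zero norm_ge_zero, of a b] by linarith
    finally show ?thesis .
  qed
  then show "AE x in lebesgue_on \<Omega>. norm (v x \<bullet> w x) \<le> norm ((norm (v x))\<^sup>2 + (norm (w x))\<^sup>2)"
    by simp
qed

lemma L2_space_iff:
  "v \<in> L2_space \<Omega> \<longleftrightarrow> v \<in> borel_measurable (lebesgue_on \<Omega>) \<and> integrable (lebesgue_on \<Omega>) (\<lambda>x. v x \<bullet> v x)"
  by (simp add: L2_space_def power2_norm_eq_inner)

lemma subspace_L2_space: "subspace (L2_space \<Omega>)"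
proof (rule subspaceI)
  show "0 \<in> L2_space \<Omega>" by (simp add: L2_space_def zero_fun_def)
next
  fix v w :: "'a \<Rightarrow> 'b" assume vw: "v \<in> L2_space \<Omega>" "w \<in> L2_space \<Omega>"
  have "integrable (lebesgue_on \<Omega>) (\<lambda>x. v x \<bullet> v x + 2 * (v x \<bullet> w x) + w x \<bullet> w x)"
    using vw by (intro Bochner_Integration.integrable_add integrable_mult_right integrable_L2_inner)
  then show "v + w \<in> L2_space \<Omega>"
    using vw[THEN L2_spaceD(1)]
    by (auto simp: L2_space_iff inner_add_left inner_add_right inner_commute algebra_simps plus_fun_def)
next
  fix c and v :: "'a \<Rightarrow> 'b" assume "v \<in> L2_space \<Omega>"
  then show "c *\<^sub>R v \<in> L2_space \<Omega>" by (auto simp: L2_space_iff scaleR_fun_def)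
qed

lemma semi_inner_L2: "semi_inner (L2_space \<Omega>) (L2_inner \<Omega>)"
proof
  show "subspace (L2_space \<Omega>)" by (rule subspace_L2_space)
  show "L2_inner \<Omega> v w = L2_inner \<Omega> w v" for v w by (simp add: L2_inner_def inner_commute)
qed (simp_all add: L2_inner_def inner_add_left integrable_L2_inner)

interpretation L2: semi_inner "L2_space \<Omega>" "L2_inner \<Omega>" for \<Omega>
  by (rule semi_inner_L2)

lemma norm_L2_nonneg [simp]: "norm_L2 \<Omega> v \<ge> 0"
  by (simp add: norm_L2_def L2_inner_def)

lemma norm_L2_power2: "(norm_L2 \<Omega> v)\<^sup>2 = L2_inner \<Omega> v v"
  by (simp add: norm_L2_def L2_inner_def)

lemmas norm_L2_triangle = L2.triangle[folded norm_L2_def]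
lemmas norm_L2_scale = L2.norm_scale[folded norm_L2_def]
lemmas L2_inner_le = L2.le_sqrt[folded norm_L2_def]

lemma norm_L2_triangle_diff:
  assumes "v \<in> L2_space \<Omega>" "w \<in> L2_space \<Omega>"
  shows "norm_L2 \<Omega> (v - w) \<le> norm_L2 \<Omega> v + norm_L2 \<Omega> w"
  using norm_L2_triangle[OF assms(1) L2.mem(3)[OF assms(2), of "-1"]]
    norm_L2_scale[OF assms(2), of "-1"] by simp

text \<open>Exchanging the representative chosen by \<open>weak_grad\<close> for a concrete gradient
  goes through this lemma.\<close>

lemma L2_inner_cong_AE:
  assumes "AE x in lebesgue_on \<Omega>. v x = v' x" "AE x in lebesgue_on \<Omega>. w x = w' x"
    and "v \<in> L2_space \<Omega>" "w \<in> L2_space \<Omega>" "v' \<in> L2_space \<Omega>" "w' \<in> L2_space \<Omega>"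
  shows "L2_inner \<Omega> v w = L2_inner \<Omega> v' w'"
  unfolding L2_inner_def
proof (rule integral_cong_AE)
  show "AE x in lebesgue_on \<Omega>. v x \<bullet> w x = v' x \<bullet> w' x" using assms by auto
qed (use assms(3-6) integrable_L2_inner in blast)+

lemma norm_L2_cong_AE:
  assumes "AE x in lebesgue_on \<Omega>. v x = v' x" "v \<in> L2_space \<Omega>" "v' \<in> L2_space \<Omega>"
  shows "norm_L2 \<Omega> v = norm_L2 \<Omega> v'"
  unfolding norm_L2_def using L2_inner_cong_AE[OF assms(1,1)] assms by simp

lemma norm_L2_eq_0_iff:
  assumes "v \<in> L2_space \<Omega>"
  shows "norm_L2 \<Omega> v = 0 \<longleftrightarrow> (AE x in lebesgue_on \<Omega>. v x = 0)"
proof -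
  have "(LINT x|lebesgue_on \<Omega>. v x \<bullet> v x) = 0 \<longleftrightarrow> (AE x in lebesgue_on \<Omega>. v x \<bullet> v x = 0)"
    using integrable_L2_inner[OF assms assms] by (intro integral_nonneg_eq_0_iff_AE) auto
  then show ?thesis by (simp add: norm_L2_def L2_inner_def)
qed

text \<open>Continuity on the whole space bounds \<open>v\<close> on the compact closure of
  \<open>\<Omega>\<close>, which has finite measure.\<close>

lemma continuous_in_L2_space:
  fixes v :: "'a::euclidean_space \<Rightarrow> 'b::euclidean_space"
  assumes "continuous_on UNIV v" "bounded \<Omega>" "open \<Omega>"
  shows "v \<in> L2_space \<Omega>"
proof -
  have m: "v \<in> borel_measurable (lebesgue_on \<Omega>)"
    using borel_measurable_continuous_onI[OF assms(1)] by (simp add: borel_measurable_if_I measurable_completion measurable_restrict_space1)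
  have "\<Omega> \<in> lmeasurable" using assms bounded_set_imp_lmeasurable lmeasurable_open by blast
  then have fin: "finite_measure (lebesgue_on \<Omega>)" by (simp add: finite_measure_lebesgue_on)
  have "compact (v ` closure \<Omega>)"
    using assms by (intro compact_continuous_image continuous_on_subset[OF assms(1)]) auto
  then obtain C where C: "\<And>x. x \<in> closure \<Omega> \<Longrightarrow> norm (v x) \<le> C"
    by (metis bounded_iff compact_imp_bounded imageI)
  have "integrable (lebesgue_on \<Omega>) (\<lambda>x. (norm (v x))\<^sup>2)"
  proof (rule finite_measure.integrable_const_bound[OF fin])
    show "AE x in lebesgue_on \<Omega>. norm ((norm (v x))\<^sup>2) \<le> C\<^sup>2"
      using C closure_subset[of \<Omega>] by (intro AE_I2) (auto intro!: power_mono)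
  qed (use m in measurable)
  then show ?thesis using m by (simp add: L2_space_def)
qed

lemma continuous_mult_L2_integrable:
  fixes v :: "'a::euclidean_space \<Rightarrow> real"
  assumes "continuous_on UNIV \<phi>" "bounded \<Omega>" "open \<Omega>" "v \<in> L2_space \<Omega>"
  shows "integrable (lebesgue_on \<Omega>) (\<lambda>x. v x * \<phi> x)"
  using integrable_L2_inner[OF assms(4) continuous_in_L2_space[OF assms(1-3)]] by simp

subsection \<open>Cut-off functions and the fundamental lemma\<close>

text \<open>The classical flat function exp(-1/t) is the case \<open>j = 0\<close>. Differentiation
  produces further powers of 1/t, so the family is indexed by them and its derivatives stay in its
  linear span.\<close>

definition bump :: "nat \<Rightarrow> real \<Rightarrow> real" where
  "bump j t = (if t \<le> 0 then 0 else exp (- (1 / t)) / t ^ j)"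

lemma bump_nonneg: "bump j t \<ge> 0"
  by (simp add: bump_def)

text \<open>With s = 1/t this is the decay of s^j exp(-s) at infinity.\<close>

lemma bump_tendsto_0: "(bump j \<longlongrightarrow> 0) (at 0)"
proof -
  have r: "(bump j \<longlongrightarrow> 0) (at_right 0)"
  proof (rule Lim_transform_eventually)
    show "((\<lambda>t. inverse t ^ j / exp (inverse t)) \<longlongrightarrow> 0) (at_right (0::real))"
      by (rule filterlim_compose[OF tendsto_power_div_exp_0 filterlim_inverse_at_top_right])
    have "bump j t = inverse t ^ j / exp (inverse t)" if "t > 0" for t
      using that by (simp add: bump_def exp_minus field_simps)
    then show "\<forall>\<^sub>F t in at_right 0. inverse t ^ j / exp (inverse t) = bump j t"
      by (auto simp: eventually_at_right_less eventually_at_filter)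
  qed
  have l: "(bump j \<longlongrightarrow> 0) (at_left 0)"
    by (rule Lim_transform_eventually[OF tendsto_const])
       (auto simp: eventually_at_filter bump_def)
  show ?thesis using l r by (simp add: filterlim_at_split)
qed

lemma bump_has_derivative:
  "(bump j has_real_derivative bump (j + 2) t - real j * bump (j + 1) t) (at t)"
proof -
  consider "t > 0" | "t < 0" | "t = 0" by linarith
  then show ?thesis
  proof cases
    case 1
    have "((\<lambda>t. exp (- (1 / t)) / t ^ j) has_real_derivative
        (exp (- (1 / t)) * (1 / t\<^sup>2) * t ^ j - exp (- (1 / t)) * (real j * t ^ (j - 1))) / (t ^ j * t ^ j)) (at t)"
      using 1 by (auto intro!: derivative_eq_intros simp: power2_eq_square)
    also have "(exp (- (1 / t)) * (1 / t\<^sup>2) * t ^ j - exp (- (1 / t)) * (real j * t ^ (j - 1))) / (t ^ j * t ^ j)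
        = bump (j + 2) t - real j * bump (j + 1) t"
      using 1 by (cases j) (auto simp: bump_def field_simps power2_eq_square)
    finally show ?thesis
      by (rule has_field_derivative_transform_within_open[of _ _ _ "{0<..}"])
         (use 1 in \<open>auto simp: bump_def\<close>)
  next
    case 2
    have "((\<lambda>t. 0) has_real_derivative bump (j + 2) t - real j * bump (j + 1) t) (at t)"
      using 2 by (simp add: bump_def)
    then show ?thesis
      by (rule has_field_derivative_transform_within_open[of _ _ _ "{..<0}"])
         (use 2 in \<open>auto simp: bump_def\<close>)
  next
    case 3
    have "((\<lambda>h. (bump j (0 + h) - bump j 0) / h) \<longlongrightarrow> 0) (at 0)"
    proof (rule Lim_transform_eventually[OF bump_tendsto_0[of "Suc j"]])
      \<comment> \<open>The difference quotient of \<open>bump j\<close> at 0 is again a member of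
        the family, whose limit is known.\<close>
      have "bump (Suc j) h = (bump j (0 + h) - bump j 0) / h" if "h \<noteq> 0" for h
        using that by (simp add: bump_def)
      then show "\<forall>\<^sub>F h in at 0. bump (Suc j) h = (bump j (0 + h) - bump j 0) / h"
        by (auto simp: eventually_at_filter)
    qed
    then show ?thesis using 3 by (simp add: DERIV_def bump_def)
  qed
qed

text \<open>A class of functions closed under partial derivatives that contains enough cut-off functions;
  the closure property makes infinite differentiability immediate.\<close>

inductive smooth :: "('a::euclidean_space \<Rightarrow> real) \<Rightarrow> bool" where
  const: "smooth (\<lambda>x. c)"
| coord: "smooth (\<lambda>x. x \<bullet> e)"
| add: "smooth f \<Longrightarrow> smooth g \<Longrightarrow> smooth (\<lambda>x. f x + g x)"
| mult: "smooth f \<Longrightarrow> smooth g \<Longrightarrow> smooth (\<lambda>x. f x * g x)"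
| comp: "smooth f \<Longrightarrow> smooth (\<lambda>x. bump j (f x))"

text \<open>Every constructor supplies its derivative explicitly, and in a fixed direction
  \<open>e\<close> this derivative is again composed of constructors; for \<open>comp\<close> that
  is \<open>bump_has_derivative\<close> with the chain rule.\<close>

lemma smooth_derivative:
  "smooth f \<Longrightarrow> \<exists>D. (\<forall>x. (f has_derivative D x) (at x)) \<and> (\<forall>e. smooth (\<lambda>x. D x e))"
proof (induction rule: smooth.induct)
  case (const c)
  show ?case by (rule exI[of _ "\<lambda>x h. 0"]) (auto intro: smooth.const)
next
  case (coord e)
  show ?case
    by (rule exI[of _ "\<lambda>x h. h \<bullet> e"]) (auto intro!: smooth.const derivative_eq_intros)
next
  case (add f g)
  then obtain D D' where *: "\<forall>x. (f has_derivative D x) (at x)" "\<forall>e. smooth (\<lambda>x. D x e)"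
    "\<forall>x. (g has_derivative D' x) (at x)" "\<forall>e. smooth (\<lambda>x. D' x e)" by blast
  show ?case
    by (rule exI[of _ "\<lambda>x h. D x h + D' x h"])
       (use * in \<open>auto intro!: smooth.add has_derivative_add\<close>)
next
  case (mult f g)
  then obtain D D' where *: "\<forall>x. (f has_derivative D x) (at x)" "\<forall>e. smooth (\<lambda>x. D x e)"
    "\<forall>x. (g has_derivative D' x) (at x)" "\<forall>e. smooth (\<lambda>x. D' x e)" by blast
  show ?case
    by (rule exI[of _ "\<lambda>x h. f x * D' x h + D x h * g x"])
       (use * mult.hyps in \<open>auto intro!: smooth.add smooth.mult has_derivative_mult\<close>)
next
  case (comp f j)
  then obtain D where *: "\<forall>x. (f has_derivative D x) (at x)" "\<forall>e. smooth (\<lambda>x. D x e)" by blast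
  let ?d = "\<lambda>x. bump (j + 2) (f x) + (- real j) * bump (j + 1) (f x)"
  have "((\<lambda>x. bump j (f x)) has_derivative (\<lambda>h. ?d x * D x h)) (at x)" for x
    using has_derivative_compose[OF *(1)[rule_format]
        bump_has_derivative[of j "f x", unfolded has_field_derivative_def]] by simp
  moreover have "smooth (\<lambda>x. ?d x * D x e)" for e
    by (intro smooth.mult smooth.add smooth.comp smooth.const *(2)[rule_format] comp.hyps)
  ultimately show ?case by (intro exI[of _ "\<lambda>x h. ?d x * D x h"]) blast
qed

lemma smooth_imp_Ck: "smooth f \<Longrightarrow> Ck m f"
proof (induction m arbitrary: f)
  case 0
  then show ?case using smooth_derivative[OF 0]
    by (auto intro!: continuous_at_imp_continuous_on dest: has_derivative_continuous)
next
  case (Suc m)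
  obtain D where D: "\<And>x. (f has_derivative D x) (at x)" "\<And>e. smooth (\<lambda>x. D x e)"
    using smooth_derivative[OF Suc.prems] by blast
  have "partial f e = (\<lambda>x. D x e)" for e
    unfolding partial_def using frechet_derivative_at[OF D(1)] by metis
  then show ?case using D Suc.IH by (auto simp: differentiable_def)
qed

section \<open>Smooth approximations of indicators of boxes\<close>

lemma smooth_prod: "finite A \<Longrightarrow> (\<And>i. i \<in> A \<Longrightarrow> smooth (f i)) \<Longrightarrow> smooth (\<lambda>x. \<Prod>i\<in>A. f i x)"
  by (induction rule: finite_induct) (auto intro: smooth.const smooth.mult)

text \<open>Differences are written with \<open>+\<close> and \<open>*\<close> so that the introduction rules of \<open>smooth\<close> match.\<close>

definition box_bump :: "'a \<Rightarrow> 'a \<Rightarrow> nat \<Rightarrow> 'a::euclidean_space \<Rightarrow> real" where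
  "box_bump a b n x = (\<Prod>i\<in>Basis. bump 0 (real n * (x \<bullet> i + - (a \<bullet> i))) * bump 0 (real n * (b \<bullet> i + - 1 * (x \<bullet> i))))"

lemma box_bump_outside:
  assumes "x \<notin> box a b"
  shows "box_bump a b n x = 0"
proof -
  obtain i where i: "i \<in> Basis" "\<not> (a \<bullet> i < x \<bullet> i \<and> x \<bullet> i < b \<bullet> i)"
    using assms by (auto simp: mem_box)
  then have "real n * (x \<bullet> i - a \<bullet> i) \<le> 0 \<or> real n * (b \<bullet> i - x \<bullet> i) \<le> 0"
    by (auto simp: mult_le_0_iff)
  then show ?thesis unfolding box_bump_def using i(1)
    by (intro prod_zero) (auto simp: bump_def)
qed

lemma bump_0_le_1: "bump 0 t \<le> 1"
  by (simp add: bump_def)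

lemma box_bump_bounds: "0 \<le> box_bump a b n x" "box_bump a b n x \<le> 1"
  unfolding box_bump_def
  by (intro prod_nonneg mult_nonneg_nonneg bump_nonneg ballI prod_le_1 conjI mult_le_one bump_0_le_1)+

lemma smooth_box_bump: "smooth (box_bump a b n)"
proof -
  have "box_bump a b n = (\<lambda>x. \<Prod>i\<in>Basis. bump 0 (real n * (x \<bullet> i + - (a \<bullet> i))) * bump 0 (real n * (b \<bullet> i + - 1 * (x \<bullet> i))))"
    by (simp add: box_bump_def fun_eq_iff)
  then show ?thesis
    by (simp only:) (intro smooth_prod finite_Basis smooth.mult smooth.comp smooth.add smooth.const smooth.coord)
qed

text \<open>For \<open>n > 0\<close>, multiplying by \<open>n\<close> keeps the signs that decide
  the support, and for \<open>y > 0\<close> it yields exp(-1/(n y)), which tends to 1. Indicators of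
  boxes are thus bounded limits of smooth functions, without any convolution.\<close>

lemma box_bump_tendsto: "(\<lambda>n. box_bump a b n x) \<longlonglongrightarrow> indicator (box a b) x"
proof (cases "x \<in> box a b")
  case True
  have bump: "(\<lambda>n. bump 0 (real n * y)) \<longlonglongrightarrow> 1" if "y > 0" for y
  proof (rule Lim_transform_eventually)
    show "(\<lambda>n. exp (- (1 / (real n * y)))) \<longlonglongrightarrow> 1"
    proof -
      have "(\<lambda>n. exp (- ((1 / y) * inverse (real n)))) \<longlonglongrightarrow> exp (- ((1 / y) * 0))"
        by (intro tendsto_intros lim_inverse_n)
      then show ?thesis by (simp add: field_simps)
    qed
    show "\<forall>\<^sub>F n in sequentially. exp (- (1 / (real n * y))) = bump 0 (real n * y)"
      using eventually_gt_at_top[of 0]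
      by eventually_elim (use that in \<open>auto simp: bump_def mult_le_0_iff\<close>)
  qed
  have "(\<lambda>n. box_bump a b n x) \<longlonglongrightarrow> (\<Prod>i\<in>(Basis::'a set). 1 * 1)"
    unfolding box_bump_def using True
    by (intro tendsto_prod tendsto_mult bump) (auto simp: mem_box)
  then show ?thesis using True by simp
next
  case False
  then show ?thesis by (simp add: box_bump_outside)
qed

lemma box_bump_test_function:
  assumes "cbox a b \<subseteq> \<Omega>"
  shows "box_bump a b n \<in> test_functions \<Omega>"
proof -
  have "closure {x. box_bump a b n x \<noteq> 0} \<subseteq> cbox a b"
    using box_bump_outside[of _ a b n] box_subset_cbox[of a b] by (intro closure_minimal) auto
  then show ?thesis using assms smooth_imp_Ck[OF smooth_box_bump]
    unfolding test_functions_def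
    by (auto intro: bounded_subset[OF bounded_cbox] simp: compact_eq_bounded_closed)
qed

text \<open>By dominated convergence along \<open>box_bump\<close>, the integral of \<open>g\<close>
  vanishes over every box whose closed box lies in \<open>\<Omega>\<close>; Lebesgue differentiation
  over shrinking cubes then yields \<open>g = 0\<close> at almost every point.\<close>

lemma fundamental_lemma_of_variations:
  fixes g :: "'a::euclidean_space \<Rightarrow> real"
  assumes "open \<Omega>" "bounded \<Omega>" "g \<in> L2_space \<Omega>"
    and 0: "\<And>\<phi>. \<phi> \<in> test_functions \<Omega> \<Longrightarrow> (LINT x|lebesgue_on \<Omega>. g x * \<phi> x) = 0"
  shows "AE x in lebesgue_on \<Omega>. g x = 0"
proof -
  have \<Omega>: "\<Omega> \<in> sets lebesgue" using assms(1) by simp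
  have int_g: "integrable (lebesgue_on \<Omega>) g"
    using continuous_mult_L2_integrable[OF continuous_on_const[of UNIV 1] assms(2,1,3)] by simp
  \<comment> \<open>Extension by zero, since the differentiation theorem concerns functions on the
    whole space.\<close>
  define G where "G x = indicator \<Omega> x *\<^sub>R g x" for x
  have int_G: "integrable lebesgue G"
    unfolding G_def using int_g \<Omega> by (simp add: integrable_restrict_space)
  have box0: "(LINT x|lebesgue_on \<Omega>. g x * indicator (box a b) x) = 0" if "cbox a b \<subseteq> \<Omega>" for a b
  proof -
    have "(\<lambda>n. LINT x|lebesgue_on \<Omega>. g x * box_bump a b n x) \<longlonglongrightarrow> (LINT x|lebesgue_on \<Omega>. g x * indicator (box a b) x)"
    proof (rule integral_dominated_convergence[where w = "\<lambda>x. norm (g x)"])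
      have m: "g \<in> borel_measurable (lebesgue_on \<Omega>)" using int_g by simp
      show "(\<lambda>x. g x * indicator (box a b) x) \<in> borel_measurable (lebesgue_on \<Omega>)"
        by (intro borel_measurable_times m measurable_restrict_space1 borel_measurable_indicator) simp
      show "(\<lambda>x. g x * box_bump a b n x) \<in> borel_measurable (lebesgue_on \<Omega>)" for n
        using continuous_mult_L2_integrable[OF smooth_imp_Ck[OF smooth_box_bump, of 0, simplified] assms(2,1,3)]
        by simp
      show "AE x in lebesgue_on \<Omega>. (\<lambda>n. g x * box_bump a b n x) \<longlonglongrightarrow> g x * indicator (box a b) x"
        by (intro AE_I2 tendsto_mult tendsto_const box_bump_tendsto)
      show "AE x in lebesgue_on \<Omega>. norm (g x * box_bump a b n x) \<le> norm (g x)" for n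
        using box_bump_bounds[of a b n]
        by (intro AE_I2) (simp add: abs_mult mult_left_le)
    qed (use int_g in simp)
    moreover have "(LINT x|lebesgue_on \<Omega>. g x * box_bump a b n x) = 0" for n
      using 0[OF box_bump_test_function[OF that]] .
    ultimately show ?thesis by (simp add: LIMSEQ_const_iff)
  qed
  \<comment> \<open>The differentiation theorem speaks of gauge integrals over closed boxes, so the
    vanishing Lebesgue integrals are translated.\<close>
  have int0: "integral (cbox a b) G = 0" if "cbox a b \<subseteq> \<Omega>" for a b
  proof -
    have i: "integrable (lebesgue_on (box a b)) G"
      using integrable_mult_indicator[OF _ int_G, of "box a b"] by (simp add: integrable_restrict_space)
    have "integral (cbox a b) G = integral (box a b) G" by (simp add: integral_open_interval)
    also have "\<dots> = (LINT x|lebesgue_on (box a b). G x)"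
      using lebesgue_integral_eq_integral[OF i] by simp
    also have "\<dots> = (LINT x|lebesgue. indicator (box a b) x *\<^sub>R G x)"
      by (simp add: integral_restrict_space)
    also have "\<dots> = (LINT x|lebesgue. indicator \<Omega> x *\<^sub>R (g x * indicator (box a b) x))"
      by (intro Bochner_Integration.integral_cong) (auto simp: G_def)
    also have "\<dots> = 0" using box0[OF that] \<Omega> by (simp add: integral_restrict_space)
    finally show ?thesis .
  qed
  have "G integrable_on cbox a b" for a b
  proof (rule integrable_on_lebesgue_on)
    show "integrable (lebesgue_on (cbox a b)) G"
      using integrable_mult_indicator[OF _ int_G, of "cbox a b"] by (simp add: integrable_restrict_space)
  qed simp
  then obtain N where N: "negligible N" "\<And>x e. \<lbrakk>x \<notin> N; 0 < e\<rbrakk> \<Longrightarrow> \<exists>d>0. \<forall>h. 0 < h \<and> h < d \<longrightarrow>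
      norm (integral (cbox x (x + h *\<^sub>R One)) G /\<^sub>R h ^ DIM('a) - G x) < e"
    using integrable_ccontinuous_explicit[of G] by metis
  have "g x = 0" if x: "x \<in> \<Omega>" "x \<notin> N" for x
  proof (rule ccontr)
    assume "g x \<noteq> 0"
    then have "0 < norm (G x)" using x by (simp add: G_def)
    from N(2)[OF x(2) this] obtain d where d: "d > 0"
      "\<And>h. 0 < h \<Longrightarrow> h < d \<Longrightarrow> norm (integral (cbox x (x + h *\<^sub>R One)) G /\<^sub>R h ^ DIM('a) - G x) < norm (G x)"
      by blast
    obtain r where r: "r > 0" "ball x r \<subseteq> \<Omega>" using assms(1) x(1) by (meson openE)
    \<comment> \<open>The l1 distance from \<open>x\<close> within the cube is at most
      \<open>h * DIM('a)\<close>, so the cube stays in the ball of radius \<open>r\<close>; the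
      halves make both bounds strict.\<close>
    define h where "h = min (d / 2) (r / (2 * DIM('a)))"
    have h: "0 < h" "h < d" "h * DIM('a) < r"
      using d(1) r(1) by (auto simp: h_def min_def field_simps)
    have "cbox x (x + h *\<^sub>R One) \<subseteq> ball x r"
    proof
      fix y assume y: "y \<in> cbox x (x + h *\<^sub>R One)"
      have "norm (y - x) \<le> (\<Sum>i\<in>Basis. \<bar>(y - x) \<bullet> i\<bar>)" by (rule norm_le_l1)
      also have "\<dots> \<le> (\<Sum>i\<in>(Basis::'a set). h)"
        using y by (intro sum_mono) (auto simp: mem_box inner_diff_left inner_add_left)
      also have "\<dots> < r" using h(3) by (simp add: mult.commute)
      finally show "y \<in> ball x r" by (simp add: dist_norm norm_minus_commute)
    qed
    then have "integral (cbox x (x + h *\<^sub>R One)) G = 0" using int0 r(2) by blast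
    \<comment> \<open>The average over the cube is 0, so the estimate would read |G x| < |G
      x|.\<close>
    then show False using d(2)[OF h(1,2)] by simp
  qed
  then have "{x \<in> \<Omega>. g x \<noteq> 0} \<subseteq> N" by auto
  then have "negligible {x \<in> \<Omega>. g x \<noteq> 0}" using N(1) negligible_subset by blast
  then have "AE x in lebesgue. x \<notin> {x \<in> \<Omega>. g x \<noteq> 0}"
    by (intro AE_not_in) (simp add: negligible_iff_null_sets)
  then show ?thesis using \<Omega> by (auto simp: AE_restrict_space_iff)
qed

subsection \<open>Integration by parts\<close>

lemma derivative_zero_outside:
  assumes "(f has_derivative D) (at x)" "closed K" "x \<notin> K" "\<And>y. y \<notin> K \<Longrightarrow> f y = 0"
  shows "D = (\<lambda>h. 0)"
proof -
  have "((\<lambda>x. 0) has_derivative D) (at x)"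
    by (rule has_derivative_transform_within_open[OF assms(1), of "- K"])
       (use assms in \<open>simp_all add: open_Compl\<close>)
  then show ?thesis using has_derivative_unique[OF _ has_derivative_const] by blast
qed

text \<open>Difference quotients of a compactly supported function integrate to zero by translation
  invariance, and they converge to the derivative under a common bound. Iterated integrals are
  avoided in this way.\<close>

lemma integral_partial_eq_0:
  fixes f :: "'a::euclidean_space \<Rightarrow> real"
  assumes der: "\<And>x. (f has_derivative D x) (at x)"
    and cont: "continuous_on UNIV (\<lambda>x. D x e)"
    and K: "compact K" "\<And>x. x \<notin> K \<Longrightarrow> f x = 0"
  shows "(LINT x|lborel. D x e) = 0"
proof -
  have D0: "D x e = 0" if "x \<notin> K" for x
    using derivative_zero_outside[OF der compact_imp_closed[OF K(1)] that K(2)] by simp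
  have "bounded ((\<lambda>x. D x e) ` K)"
    using K(1) continuous_on_subset[OF cont] by (intro compact_imp_bounded compact_continuous_image) auto
  then obtain M0 where M0: "\<And>x. x \<in> K \<Longrightarrow> \<bar>D x e\<bar> \<le> M0"
    by (auto simp: bounded_iff)
  define M where "M = max M0 0"
  have M: "\<bar>D x e\<bar> \<le> M" for x using M0[of x] D0[of x] by (cases "x \<in> K") (auto simp: M_def)
  obtain R where R: "\<And>x. x \<in> K \<Longrightarrow> norm x \<le> R"
    using compact_imp_bounded[OF K(1)] by (auto simp: bounded_iff)
  \<comment> \<open>The steps \<open>h n\<close> are at most 1, so for \<open>x\<close> outside this
    ball both points of the difference quotient lie outside \<open>K\<close>.\<close>
  define S where "S = cball (0::'a) (R + norm e)"
  have contf: "continuous_on UNIV f"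
    using der by (auto intro!: continuous_at_imp_continuous_on dest: has_derivative_continuous)
  have int_f: "integrable lborel f"
  proof -
    have "integrable lborel (\<lambda>x. indicator K x *\<^sub>R f x)"
      by (rule borel_integrable_compact[OF K(1) continuous_on_subset[OF contf]]) simp
    moreover have "(\<lambda>x. indicator K x *\<^sub>R f x) = f" using K(2) by (auto simp: indicator_def fun_eq_iff)
    ultimately show ?thesis by simp
  qed
  have mf: "f \<in> borel_measurable borel" using contf by (rule borel_measurable_continuous_onI)
  have shift: "integrable lborel (\<lambda>x. f (c + x))" "(LINT x|lborel. f (c + x)) = (LINT x|lborel. f x)" for c
  proof -
    have d: "distr lborel borel ((+) c) = (lborel :: 'a measure)" by (rule lborel_distr_plus)
    have "integrable (distr lborel borel ((+) c)) f" using int_f d by simp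
    then show "integrable lborel (\<lambda>x. f (c + x))" by (subst (asm) integrable_distr_eq) (use mf in auto)
    have "(LINT x|lborel. f x) = (LINT x|distr lborel borel ((+) c). f x)" using d by simp
    also have "\<dots> = (LINT x|lborel. f (c + x))" by (rule integral_distr) (use mf in auto)
    finally show "(LINT x|lborel. f (c + x)) = (LINT x|lborel. f x)" by simp
  qed
  have line: "((\<lambda>t. f (t *\<^sub>R e + x)) has_real_derivative D (t *\<^sub>R e + x) e) (at t)" for x t
  proof -
    have "((\<lambda>t. f (t *\<^sub>R e + x)) has_derivative (\<lambda>s. D (t *\<^sub>R e + x) (s *\<^sub>R e))) (at t)"
      by (rule has_derivative_compose[OF _ der]) (auto intro!: derivative_eq_intros)
    moreover have "D y (s *\<^sub>R e) = D y e * s" for y s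
      using linear_scale[OF has_derivative_linear[OF der]] by simp
    ultimately show ?thesis by (simp add: has_field_derivative_def)
  qed
  define h where "h n = inverse (real (Suc n))" for n
  have h: "0 < h n" "h n \<le> 1" for n by (auto simp: h_def field_simps)
  have h0: "filterlim h (at 0) sequentially"
    using LIMSEQ_inverse_real_of_nat h(1) unfolding h_def
    by (intro filterlim_atI) (auto intro: always_eventually)
  define q where "q n x = (f (h n *\<^sub>R e + x) - f x) / h n" for n x
  have "(\<lambda>n. LINT x|lborel. q n x) \<longlonglongrightarrow> (LINT x|lborel. D x e)"
  proof (rule integral_dominated_convergence[where w = "\<lambda>x. M * indicator S x"])
    show "(\<lambda>x. D x e) \<in> borel_measurable lborel"
      using borel_measurable_continuous_onI[OF cont] by simp
    show "q n \<in> borel_measurable lborel" for n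
      unfolding q_def using shift(1) int_f by (intro borel_measurable_integrable) simp
    show "integrable lborel (\<lambda>x. M * indicator S x)"
      using emeasure_compact_finite[of S] by (intro integrable_mult_right integrable_real_indicator) (auto simp: S_def)
    have "(\<lambda>n. q n x) \<longlonglongrightarrow> D x e" for x
    proof -
      have "((\<lambda>s. (f ((0 + s) *\<^sub>R e + x) - f (0 *\<^sub>R e + x)) / s) \<longlongrightarrow> D x e) (at 0)"
        using line[of x 0] by (simp add: DERIV_def)
      from filterlim_compose[OF this h0] show ?thesis by (simp add: q_def)
    qed
    then show "AE x in lborel. (\<lambda>n. q n x) \<longlonglongrightarrow> D x e" by simp
    have "\<bar>q n x\<bar> \<le> M * indicator S x" for n x
    proof (cases "x \<in> S")
      case True
      \<comment> \<open>The mean value theorem makes the quotient a value of the derivative, bounded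
        by \<open>M\<close> uniformly in \<open>n\<close>.\<close>
      obtain z where "f (h n *\<^sub>R e + x) - f (0 *\<^sub>R e + x) = (h n - 0) * D (z *\<^sub>R e + x) e"
        using MVT2[OF h(1)[of n], of "\<lambda>t. f (t *\<^sub>R e + x)" "\<lambda>t. D (t *\<^sub>R e + x) e"] line by blast
      then have "q n x = D (z *\<^sub>R e + x) e" using h(1)[of n] by (simp add: q_def)
      then show ?thesis using True M by simp
    next
      case False
      then have n: "norm x > R + norm e" by (simp add: S_def)
      have "norm (h n *\<^sub>R e) \<le> norm e"
        using h[of n] mult_right_mono[of "h n" 1 "norm e"] by simp
      then have "norm (h n *\<^sub>R e + x) > R"
        using n norm_triangle_ineq2[of x "- (h n *\<^sub>R e)"] by (simp add: add.commute)
      then have "f (h n *\<^sub>R e + x) = 0" using K(2) R by (meson not_le)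
      moreover have "norm x > R" using n norm_ge_zero[of e] by linarith
      then have "f x = 0" using K(2) R by (meson not_le)
      ultimately show ?thesis using False by (simp add: q_def)
    qed
    then show "AE x in lborel. norm (q n x) \<le> M * indicator S x" for n by simp
  qed
  moreover have "(LINT x|lborel. q n x) = 0" for n
    unfolding q_def using shift int_f by simp
  ultimately show ?thesis by (simp add: LIMSEQ_const_iff)
qed

lemma integral_lebesgue_on_eq_lborel:
  fixes f :: "'a::euclidean_space \<Rightarrow> real"
  assumes "f \<in> borel_measurable borel" "\<And>x. x \<notin> \<Omega> \<Longrightarrow> f x = 0" "\<Omega> \<in> sets lebesgue"
  shows "(LINT x|lebesgue_on \<Omega>. f x) = (LINT x|lborel. f x)"
proof -
  have "(LINT x|lebesgue_on \<Omega>. f x) = (LINT x|lebesgue. indicator \<Omega> x *\<^sub>R f x)"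
    using assms(3) by (simp add: integral_restrict_space)
  also have "\<dots> = (LINT x|lebesgue. f x)"
    using assms(2) by (intro Bochner_Integration.integral_cong) (auto simp: indicator_def)
  also have "\<dots> = (LINT x|lborel. f x)" using assms(1) by (simp add: integral_completion)
  finally show ?thesis .
qed

section \<open>Test functions as a vector space\<close>

lemma test_functionD:
  assumes "\<phi> \<in> test_functions \<Omega>"
  shows "(\<phi> has_derivative frechet_derivative \<phi> (at x)) (at x)" "continuous_on UNIV \<phi>"
    and "e \<in> Basis \<Longrightarrow> continuous_on UNIV (partial \<phi> e)"
    and "compact (closure {x. \<phi> x \<noteq> 0})" "closure {x. \<phi> x \<noteq> 0} \<subseteq> \<Omega>"
proof -
  have Ck: "Ck m \<phi>" for m using assms by (simp add: test_functions_def)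
  show "(\<phi> has_derivative frechet_derivative \<phi> (at x)) (at x)"
    using Ck[of "Suc 0"] by (simp add: frechet_derivative_works)
  show "continuous_on UNIV \<phi>" using Ck[of 0] by simp
  show "continuous_on UNIV (partial \<phi> e)" if "e \<in> Basis" using Ck[of "Suc 0"] that by simp
qed (use assms in \<open>auto simp: test_functions_def\<close>)

text \<open>For a sum only a compact superset of the support is readily available, namely the union
  of the two supports.\<close>

lemma test_functionI:
  assumes "\<And>m. Ck m \<phi>" "compact K" "K \<subseteq> \<Omega>" "\<And>x. x \<notin> K \<Longrightarrow> \<phi> x = 0"
  shows "\<phi> \<in> test_functions \<Omega>"
proof -
  have "closure {x. \<phi> x \<noteq> 0} \<subseteq> K"
    using assms(4) by (intro closure_minimal compact_imp_closed assms(2)) blast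
  then have "compact (closure {x. \<phi> x \<noteq> 0})" "closure {x. \<phi> x \<noteq> 0} \<subseteq> \<Omega>"
    using compact_Int_closed[OF assms(2) closed_closure, of "{x. \<phi> x \<noteq> 0}"] assms(3)
    by (auto simp: Int_absorb1)
  then show ?thesis using assms(1) by (simp add: test_functions_def)
qed

lemma test_function_zero:
  "\<phi> \<in> test_functions \<Omega> \<Longrightarrow> x \<notin> closure {x. \<phi> x \<noteq> 0} \<Longrightarrow> \<phi> x = 0"
  using closure_subset[of "{x. \<phi> x \<noteq> 0}"] by blast

lemma partial_eq: "(f has_derivative D) (at x) \<Longrightarrow> partial f e x = D e"
  unfolding partial_def using frechet_derivative_at by metis

lemma partial_add:
  assumes "f differentiable (at x)" "g differentiable (at x)"
  shows "partial (f + g) e x = partial f e x + partial g e x"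
  using partial_eq[OF has_derivative_add[OF assms[unfolded frechet_derivative_works]]]
  by (simp add: partial_def plus_fun_def)

lemma partial_scaleR:
  fixes f :: "'a::euclidean_space \<Rightarrow> real"
  assumes "f differentiable (at x)"
  shows "partial (c *\<^sub>R f) e x = c * partial f e x"
  using partial_eq[OF has_derivative_scaleR_right[OF assms[unfolded frechet_derivative_works], of c]]
  by (simp add: partial_def scaleR_fun_def)

lemma Ck_add: "Ck m f \<Longrightarrow> Ck m g \<Longrightarrow> Ck m (f + g)"
proof (induction m arbitrary: f g)
  case 0
  then show ?case by (auto simp: plus_fun_def intro: continuous_on_add)
next
  case (Suc m)
  have "partial (f + g) e = partial f e + partial g e" for e
    using Suc.prems by (auto simp: fun_eq_iff partial_add)
  moreover have "f + g differentiable (at x)" for x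
    using Suc.prems unfolding plus_fun_def by (auto intro: differentiable_add)
  ultimately show ?case using Suc.IH Suc.prems by (metis Ck.simps(2))
qed

lemma Ck_scaleR: "Ck m f \<Longrightarrow> Ck m (c *\<^sub>R f)"
proof (induction m arbitrary: f)
  case 0
  then show ?case by (auto simp: scaleR_fun_def intro!: continuous_intros)
next
  case (Suc m)
  have "partial (c *\<^sub>R f) e = c *\<^sub>R partial f e" for e
    using Suc.prems by (auto simp: fun_eq_iff partial_scaleR)
  moreover have "c *\<^sub>R f differentiable (at x)" for x
    using Suc.prems unfolding scaleR_fun_def by (auto intro!: differentiable_cmult_left_iff[THEN iffD2])
  ultimately show ?case using Suc.IH Suc.prems by (metis Ck.simps(2))
qed

lemma subspace_test_functions: "subspace (test_functions \<Omega>)"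
proof (rule subspaceI)
  show "0 \<in> test_functions \<Omega>"
    unfolding test_functions_def zero_fun_def using smooth_imp_Ck[OF smooth.const[of 0]] by auto
next
  fix f g :: "'a \<Rightarrow> real" assume fg: "f \<in> test_functions \<Omega>" "g \<in> test_functions \<Omega>"
  let ?K = "closure {x. f x \<noteq> 0} \<union> closure {x. g x \<noteq> 0}"
  show "f + g \<in> test_functions \<Omega>"
  proof (rule test_functionI)
    show "Ck m (f + g)" for m using fg Ck_add unfolding test_functions_def by blast
    show "compact ?K" by (intro compact_Un test_functionD(4)[OF fg(1)] test_functionD(4)[OF fg(2)])
    show "?K \<subseteq> \<Omega>" using test_functionD(5)[OF fg(1)] test_functionD(5)[OF fg(2)] by blast
    show "(f + g) x = 0" if "x \<notin> ?K" for x
      using test_function_zero[OF fg(1), of x] test_function_zero[OF fg(2), of x] that by (simp only: Un_iff de_Morgan_disj plus_fun_apply) simp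
  qed
next
  fix c and f :: "'a \<Rightarrow> real" assume f: "f \<in> test_functions \<Omega>"
  show "c *\<^sub>R f \<in> test_functions \<Omega>"
  proof (rule test_functionI[OF _ test_functionD(4,5)[OF f]])
    show "Ck m (c *\<^sub>R f)" for m using f Ck_scaleR unfolding test_functions_def by blast
    show "(c *\<^sub>R f) x = 0" if "x \<notin> closure {x. f x \<noteq> 0}" for x
      using test_function_zero[OF f that] by simp
  qed
qed

text \<open>The product of \<open>\<psi>\<close> and \<open>\<phi>\<close> has compact support, so
  its partial derivative integrates to zero. Later \<open>\<psi>\<close> is a test function or a
  test function times a coordinate.\<close>

lemma integration_by_parts:
  fixes \<psi> :: "'a::euclidean_space \<Rightarrow> real"
  assumes \<Omega>: "open \<Omega>" "bounded \<Omega>" and \<phi>: "\<phi> \<in> test_functions \<Omega>" and e: "e \<in> Basis"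
    and der: "\<And>x. (\<psi> has_derivative D x) (at x)" and cont: "continuous_on UNIV (\<lambda>x. D x e)"
  shows "(LINT x|lebesgue_on \<Omega>. \<psi> x * partial \<phi> e x) = - (LINT x|lebesgue_on \<Omega>. D x e * \<phi> x)"
proof -
  note t = test_functionD[OF \<phi>]
  have c\<psi>: "continuous_on UNIV \<psi>"
    using der by (auto intro!: continuous_at_imp_continuous_on dest: has_derivative_continuous)
  have c: "continuous_on UNIV (\<lambda>x. \<psi> x * partial \<phi> e x)" "continuous_on UNIV (\<lambda>x. D x e * \<phi> x)"
    by (intro continuous_on_mult c\<psi> cont t e)+
  have i: "integrable (lebesgue_on \<Omega>) (\<lambda>x. \<psi> x * partial \<phi> e x)"
    "integrable (lebesgue_on \<Omega>) (\<lambda>x. D x e * \<phi> x)"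
    by (intro continuous_mult_L2_integrable continuous_in_L2_space t \<Omega> c\<psi> cont e)+
  let ?K = "closure {x. \<phi> x \<noteq> 0}"
  note z = test_function_zero[OF \<phi>]
  have pz: "partial \<phi> e x = 0" if "x \<notin> ?K" for x
    using derivative_zero_outside[OF t(1) closed_closure that z] by (simp add: partial_def)
  let ?F = "\<lambda>x. \<psi> x * partial \<phi> e x + D x e * \<phi> x"
  have "(LINT x|lebesgue_on \<Omega>. \<psi> x * partial \<phi> e x) + (LINT x|lebesgue_on \<Omega>. D x e * \<phi> x)
      = (LINT x|lebesgue_on \<Omega>. ?F x)"
    using i by simp
  also have "\<dots> = (LINT x|lborel. ?F x)"
  proof (rule integral_lebesgue_on_eq_lborel)
    show "?F \<in> borel_measurable borel"
      by (intro borel_measurable_continuous_onI continuous_on_add c)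
    show "?F x = 0" if "x \<notin> \<Omega>" for x
    proof -
      have "x \<notin> ?K" using t(5) that by blast
      from z[OF this] pz[OF this] show ?thesis by simp
    qed
  qed (use \<Omega> in simp)
  also have "\<dots> = 0"
    unfolding partial_def
  proof (rule integral_partial_eq_0[where f = "\<lambda>x. \<psi> x * \<phi> x" and K = ?K
        and D = "\<lambda>x h. \<psi> x * frechet_derivative \<phi> (at x) h + D x h * \<phi> x"])
    show "((\<lambda>x. \<psi> x * \<phi> x) has_derivative (\<lambda>h. \<psi> x * frechet_derivative \<phi> (at x) h + D x h * \<phi> x)) (at x)" for x
      by (intro has_derivative_mult der t)
    show "continuous_on UNIV (\<lambda>x. \<psi> x * frechet_derivative \<phi> (at x) e + D x e * \<phi> x)"
      using continuous_on_add[OF c] by (simp add: partial_def)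
    show "\<psi> x * \<phi> x = 0" if "x \<notin> ?K" for x using z[OF that] by simp
  qed (rule t(4))
  finally show ?thesis by linarith
qed

definition grad :: "('a::euclidean_space \<Rightarrow> real) \<Rightarrow> 'a \<Rightarrow> 'a" where
  "grad \<phi> x = (\<Sum>e\<in>Basis. partial \<phi> e x *\<^sub>R e)"

lemma grad_inner_Basis: "e \<in> Basis \<Longrightarrow> grad \<phi> x \<bullet> e = partial \<phi> e x"
  by (simp add: grad_def)

lemma test_function_has_weak_gradient:
  assumes "open \<Omega>" "bounded \<Omega>" "\<phi> \<in> test_functions \<Omega>"
  shows "has_weak_gradient \<Omega> \<phi> (grad \<phi>)"
  unfolding has_weak_gradient_def
proof (intro conjI ballI)
  have "continuous_on UNIV (grad \<phi>)"
    unfolding grad_def by (intro continuous_intros test_functionD[OF assms(3)])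
  then show "grad \<phi> \<in> L2_space \<Omega>" by (intro continuous_in_L2_space assms)
  fix \<psi> and e :: 'a assume "\<psi> \<in> test_functions \<Omega>" "e \<in> Basis"
  then show "(LINT x|lebesgue_on \<Omega>. \<phi> x * partial \<psi> e x) = - (LINT x|lebesgue_on \<Omega>. grad \<phi> x \<bullet> e * \<psi> x)"
    using integration_by_parts[OF assms(1,2), of \<psi> e \<phi> "\<lambda>x. frechet_derivative \<phi> (at x)"]
      test_functionD[OF assms(3)]
    by (simp add: grad_inner_Basis partial_def)
qed

section \<open>The Poincare inequality for test functions\<close>

lemma norm_L2_mono:
  assumes "v \<in> L2_space \<Omega>" "w \<in> L2_space \<Omega>" "AE x in lebesgue_on \<Omega>. norm (v x) \<le> norm (w x)"
  shows "norm_L2 \<Omega> v \<le> norm_L2 \<Omega> w"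
  unfolding norm_L2_def L2_inner_def
proof (rule real_sqrt_le_mono, rule integral_mono_AE)
  show "AE x in lebesgue_on \<Omega>. v x \<bullet> v x \<le> w x \<bullet> w x"
    using assms(3) by eventually_elim (simp add: norm_le)
qed (intro integrable_L2_inner assms)+

text \<open>The coordinate \<open>x \<bullet> e\<close> has derivative 1 in direction
  \<open>e\<close> and is bounded by \<open>R\<close>. Inserting this 1 into the integral of
  \<phi>^2 and integrating by parts leaves -2 times the integral of (x \<bullet> e) \<phi> times the
  partial derivative of \<phi>; Cauchy-Schwarz yields \<open>2 * R\<close>.\<close>

lemma Poincare_test_function:
  fixes \<phi> :: "'a::euclidean_space \<Rightarrow> real"
  assumes "open \<Omega>" "bounded \<Omega>" and R: "\<And>x. x \<in> \<Omega> \<Longrightarrow> norm x \<le> R" "R > 0"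
    and \<phi>: "\<phi> \<in> test_functions \<Omega>"
  shows "norm_L2 \<Omega> \<phi> \<le> 2 * R * norm_L2 \<Omega> (grad \<phi>)"
proof -
  note t = test_functionD[OF \<phi>]
  obtain e :: 'a where e: "e \<in> Basis" using nonempty_Basis by blast
  let ?\<psi> = "\<lambda>x. \<phi> x * (x \<bullet> e)"
  have \<psi>: "?\<psi> \<in> L2_space \<Omega>" by (intro continuous_in_L2_space continuous_intros t assms)
  have \<phi>L: "\<phi> \<in> L2_space \<Omega>" by (intro continuous_in_L2_space t assms)
  have p: "partial \<phi> e \<in> L2_space \<Omega>" by (intro continuous_in_L2_space t assms e)
  have g: "grad \<phi> \<in> L2_space \<Omega>"
    using test_function_has_weak_gradient[OF assms(1,2) \<phi>] by (simp add: has_weak_gradient_def)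
  have d: "(?\<psi> has_derivative (\<lambda>h. \<phi> x * (h \<bullet> e) + frechet_derivative \<phi> (at x) h * (x \<bullet> e))) (at x)" for x
    by (intro has_derivative_mult t has_derivative_inner_left has_derivative_ident)
  have dc: "continuous_on UNIV (\<lambda>x. \<phi> x * (e \<bullet> e) + frechet_derivative \<phi> (at x) e * (x \<bullet> e))"
    using t(3)[OF e] by (intro continuous_intros t) (simp add: partial_def[abs_def])
  \<comment> \<open>The product rule reproduces the left-hand side on the right; collecting the two
    copies gives the factor 2.\<close>
  have "L2_inner \<Omega> ?\<psi> (partial \<phi> e)
      = - (LINT x|lebesgue_on \<Omega>. (\<phi> x * (e \<bullet> e) + partial \<phi> e x * (x \<bullet> e)) * \<phi> x)"
    using integration_by_parts[OF assms(1,2) \<phi> e d dc] by (simp add: L2_inner_def partial_def)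
  also have "\<dots> = - (LINT x|lebesgue_on \<Omega>. \<phi> x \<bullet> \<phi> x + ?\<psi> x \<bullet> partial \<phi> e x)"
    using e by (intro arg_cong[where f = uminus] Bochner_Integration.integral_cong) (auto simp: algebra_simps)
  also have "\<dots> = - (L2_inner \<Omega> \<phi> \<phi> + L2_inner \<Omega> ?\<psi> (partial \<phi> e))"
    unfolding L2_inner_def
    by (subst Bochner_Integration.integral_add[OF integrable_L2_inner[OF \<phi>L \<phi>L] integrable_L2_inner[OF \<psi> p]]) simp
  finally have "(norm_L2 \<Omega> \<phi>)\<^sup>2 = 2 * - L2_inner \<Omega> ?\<psi> (partial \<phi> e)"
    by (simp add: norm_L2_power2)
  also have "\<dots> \<le> 2 * (norm_L2 \<Omega> ?\<psi> * norm_L2 \<Omega> (partial \<phi> e))"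
    using abs_le_D2[OF L2_inner_le[OF \<psi> p]] by (rule mult_left_mono) simp
  also have "norm_L2 \<Omega> ?\<psi> * norm_L2 \<Omega> (partial \<phi> e) \<le> (R * norm_L2 \<Omega> \<phi>) * norm_L2 \<Omega> (grad \<phi>)"
  proof (rule mult_mono)
    have "norm_L2 \<Omega> ?\<psi> \<le> norm_L2 \<Omega> (R *\<^sub>R \<phi>)"
    proof (rule norm_L2_mono[OF \<psi> L2.mem(3)[OF \<phi>L]], rule AE_I2)
      fix x assume "x \<in> space (lebesgue_on \<Omega>)"
      then have "\<bar>x \<bullet> e\<bar> \<le> R" using R(1)[of x] Basis_le_norm[OF e, of x] by simp
      then show "norm (?\<psi> x) \<le> norm ((R *\<^sub>R \<phi>) x)"
        using R(2) mult_left_mono[of "\<bar>x \<bullet> e\<bar>" R "\<bar>\<phi> x\<bar>"] by (simp add: abs_mult mult.commute[of R])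
    qed
    then show "norm_L2 \<Omega> ?\<psi> \<le> R * norm_L2 \<Omega> \<phi>" using norm_L2_scale[OF \<phi>L, of R] R(2) by simp
    show "norm_L2 \<Omega> (partial \<phi> e) \<le> norm_L2 \<Omega> (grad \<phi>)"
    proof (rule norm_L2_mono[OF p g], rule AE_I2)
      show "norm (partial \<phi> e x) \<le> norm (grad \<phi> x)" for x
        using Basis_le_norm[OF e, of "grad \<phi> x"] by (simp add: grad_inner_Basis[OF e])
    qed
  qed (use R(2) in simp_all)
  finally have *: "norm_L2 \<Omega> \<phi> * norm_L2 \<Omega> \<phi> \<le> (2 * R * norm_L2 \<Omega> (grad \<phi>)) * norm_L2 \<Omega> \<phi>"
    by (simp add: power2_eq_square algebra_simps)
  show ?thesis
  proof (cases "norm_L2 \<Omega> \<phi> = 0")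
    case False
    then have "norm_L2 \<Omega> \<phi> > 0" using norm_L2_nonneg[of \<Omega> \<phi>] by linarith
    then show ?thesis using * by (rule mult_right_le_imp_le[rotated])
  qed (use R(2) in simp)
qed

subsection \<open>Weak gradients and the Poincare inequality\<close>

lemma has_weak_gradient_L2: "has_weak_gradient \<Omega> v g \<Longrightarrow> g \<in> L2_space \<Omega>"
  by (simp add: has_weak_gradient_def)

lemma L2_space_inner_right: "v \<in> L2_space \<Omega> \<Longrightarrow> (\<lambda>x. v x \<bullet> e) \<in> L2_space \<Omega>"
proof -
  assume v: "v \<in> L2_space \<Omega>"
  have m: "(\<lambda>x. v x \<bullet> e) \<in> borel_measurable (lebesgue_on \<Omega>)"
    using L2_spaceD(1)[OF v] by measurable
  have "integrable (lebesgue_on \<Omega>) (\<lambda>x. (norm (v x \<bullet> e))\<^sup>2)"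
  proof (rule Bochner_Integration.integrable_bound)
    show "integrable (lebesgue_on \<Omega>) (\<lambda>x. (norm (v x))\<^sup>2 * (norm e)\<^sup>2)"
      using L2_spaceD(2)[OF v] by simp
    show "(\<lambda>x. (norm (v x \<bullet> e))\<^sup>2) \<in> borel_measurable (lebesgue_on \<Omega>)"
      using m by measurable
    show "AE x in lebesgue_on \<Omega>. norm ((norm (v x \<bullet> e))\<^sup>2) \<le> norm ((norm (v x))\<^sup>2 * (norm e)\<^sup>2)"
      using Cauchy_Schwarz_ineq2 by (intro AE_I2) (simp flip: power_mult_distrib add: abs_le_square_iff[symmetric] abs_mult)
  qed
  then show ?thesis using m by (simp add: L2_space_def)
qed

lemma has_weak_gradient_scaleR:
  assumes "has_weak_gradient \<Omega> v g"
  shows "has_weak_gradient \<Omega> (c *\<^sub>R v) (c *\<^sub>R g)"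
  using assms L2.mem(3)[of g \<Omega> c] by (simp add: has_weak_gradient_def mult.assoc)

lemma H1_spaceD:
  assumes "v \<in> H1_space \<Omega>"
  shows "v \<in> L2_space \<Omega>" "has_weak_gradient \<Omega> v (weak_grad \<Omega> v)" "weak_grad \<Omega> v \<in> L2_space \<Omega>"
proof -
  show "v \<in> L2_space \<Omega>" using assms by (simp add: H1_space_def)
  show h: "has_weak_gradient \<Omega> v (weak_grad \<Omega> v)"
    using assms unfolding weak_grad_def H1_space_def
    by (metis (mono_tags, lifting) mem_Collect_eq someI_ex)
  show "weak_grad \<Omega> v \<in> L2_space \<Omega>" using has_weak_gradient_L2[OF h] .
qed

lemma H1_spaceI: "\<lbrakk>v \<in> L2_space \<Omega>; has_weak_gradient \<Omega> v g\<rbrakk> \<Longrightarrow> v \<in> H1_space \<Omega>"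
  by (auto simp: H1_space_def)

text \<open>Linearity of \<open>T\<close> is asked only almost everywhere because
  \<open>weak_grad\<close> picks a representative separately for each function.
  \<open>L2_inner\<close> does not see the difference, so the pulled back form is bilinear
  exactly.\<close>

lemma semi_inner_L2_pullback:
  assumes "subspace E" "\<And>x. x \<in> E \<Longrightarrow> T x \<in> L2_space \<Omega>"
    and add: "\<And>x y. x \<in> E \<Longrightarrow> y \<in> E \<Longrightarrow> AE z in lebesgue_on \<Omega>. T (x + y) z = T x z + T y z"
    and scale: "\<And>c x. x \<in> E \<Longrightarrow> AE z in lebesgue_on \<Omega>. T (c *\<^sub>R x) z = c *\<^sub>R T x z"
  shows "semi_inner E (\<lambda>x y. L2_inner \<Omega> (T x) (T y))"
proof
  show "subspace E" by fact
  show "L2_inner \<Omega> (T x) (T y) = L2_inner \<Omega> (T y) (T x)" if "x \<in> E" "y \<in> E" for x y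
    using that assms(2) L2.sym by blast
  show "L2_inner \<Omega> (T (x + y)) (T z) = L2_inner \<Omega> (T x) (T z) + L2_inner \<Omega> (T y) (T z)"
    if "x \<in> E" "y \<in> E" "z \<in> E" for x y z
  proof -
    have "L2_inner \<Omega> (T (x + y)) (T z) = L2_inner \<Omega> (T x + T y) (T z)"
      using add[OF that(1,2)] that assms(2) subspace_add[OF assms(1)]
      by (intro L2_inner_cong_AE L2.mem) auto
    also have "\<dots> = L2_inner \<Omega> (T x) (T z) + L2_inner \<Omega> (T y) (T z)"
      by (intro L2.add_left assms that)
    finally show ?thesis .
  qed
  show "L2_inner \<Omega> (T (c *\<^sub>R x)) (T y) = c * L2_inner \<Omega> (T x) (T y)" if "x \<in> E" "y \<in> E" for c x y
  proof -
    have "L2_inner \<Omega> (T (c *\<^sub>R x)) (T y) = L2_inner \<Omega> (c *\<^sub>R T x) (T y)"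
      using scale[OF that(1), of c] that assms(2) subspace_scale[OF assms(1)]
      by (intro L2_inner_cong_AE L2.mem) auto
    also have "\<dots> = c * L2_inner \<Omega> (T x) (T y)"
      by (intro L2.scale_left assms that)
    finally show ?thesis .
  qed
  show "0 \<le> L2_inner \<Omega> (T x) (T x)" if "x \<in> E" for x
    using L2.nonneg assms(2) that by blast
qed

definition grad_norm :: "'a::euclidean_space set \<Rightarrow> ('a \<Rightarrow> real) \<Rightarrow> real" where
  "grad_norm \<Omega> v = norm_L2 \<Omega> (weak_grad \<Omega> v)"

lemma grad_norm_nonneg [simp]: "0 \<le> grad_norm \<Omega> v"
  by (simp add: grad_norm_def)

lemma norm_H1_le_sum: "norm_H1 \<Omega> v \<le> norm_L2 \<Omega> v + grad_norm \<Omega> v"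
  unfolding norm_H1_def grad_norm_def by (rule sqrt_sum_squares_le_sum) auto

lemma norm_L2_le_norm_H1: "norm_L2 \<Omega> v \<le> norm_H1 \<Omega> v"
  unfolding norm_H1_def by (rule real_sqrt_sum_squares_ge1)

lemma grad_norm_le_norm_H1: "grad_norm \<Omega> v \<le> norm_H1 \<Omega> v"
  unfolding norm_H1_def grad_norm_def by (rule real_sqrt_sum_squares_ge2)

lemma H10_space_iff:
  "v \<in> H10_space \<Omega> \<longleftrightarrow> v \<in> H1_space \<Omega> \<and> (\<forall>\<epsilon>>0. \<exists>\<phi>\<in>test_functions \<Omega>. norm_H1 \<Omega> (v - \<phi>) < \<epsilon>)"
  by (simp add: H10_space_def fun_diff_def)

lemma H10_H1: "v \<in> H10_space \<Omega> \<Longrightarrow> v \<in> H1_space \<Omega>"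
  by (simp add: H10_space_iff)

context
  fixes \<Omega> :: "'a::euclidean_space set"
  assumes \<Omega>: "open \<Omega>" "bounded \<Omega>"
begin

lemma test_function_L2: "\<phi> \<in> test_functions \<Omega> \<Longrightarrow> \<phi> \<in> L2_space \<Omega>"
  by (intro continuous_in_L2_space test_functionD \<Omega>)

text \<open>Each component of \<open>g - h\<close> is orthogonal to all test functions, so the
  fundamental lemma applies componentwise.\<close>

lemma weak_gradient_unique:
  assumes "has_weak_gradient \<Omega> v g" "has_weak_gradient \<Omega> v h"
  shows "AE x in lebesgue_on \<Omega>. g x = h x"
proof -
  have gh: "g \<in> L2_space \<Omega>" "h \<in> L2_space \<Omega>" using assms has_weak_gradient_L2 by blast+
  have "AE x in lebesgue_on \<Omega>. (g - h) x \<bullet> e = 0" if e: "e \<in> Basis" for e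
  proof (rule fundamental_lemma_of_variations[OF \<Omega>])
    show "(\<lambda>x. (g - h) x \<bullet> e) \<in> L2_space \<Omega>"
      using gh by (intro L2_space_inner_right L2.mem)
    fix \<phi> assume \<phi>: "\<phi> \<in> test_functions \<Omega>"
    have i: "integrable (lebesgue_on \<Omega>) (\<lambda>x. (g x \<bullet> e) * \<phi> x)" "integrable (lebesgue_on \<Omega>) (\<lambda>x. (h x \<bullet> e) * \<phi> x)"
      by (intro continuous_mult_L2_integrable test_functionD(2)[OF \<phi>] L2_space_inner_right \<Omega> gh)+
    have "(LINT x|lebesgue_on \<Omega>. (g x \<bullet> e) * \<phi> x) = (LINT x|lebesgue_on \<Omega>. (h x \<bullet> e) * \<phi> x)"
      using assms \<phi> e unfolding has_weak_gradient_def by fastforce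
    then show "(LINT x|lebesgue_on \<Omega>. (g - h) x \<bullet> e * \<phi> x) = 0"
      using i by (simp add: inner_diff_left left_diff_distrib)
  qed
  then have "AE x in lebesgue_on \<Omega>. \<forall>e\<in>Basis. (g - h) x \<bullet> e = 0"
    by (simp add: AE_finite_all)
  then show ?thesis
    by eventually_elim (auto intro: euclidean_eqI simp: inner_diff_left)
qed

lemma has_weak_gradient_add:
  assumes "v \<in> L2_space \<Omega>" "w \<in> L2_space \<Omega>" "has_weak_gradient \<Omega> v g" "has_weak_gradient \<Omega> w h"
  shows "has_weak_gradient \<Omega> (v + w) (g + h)"
  unfolding has_weak_gradient_def
proof (intro conjI ballI)
  have gh: "g \<in> L2_space \<Omega>" "h \<in> L2_space \<Omega>" using assms has_weak_gradient_L2 by blast+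
  then show "g + h \<in> L2_space \<Omega>" by (rule L2.mem)
  fix \<phi> and e :: 'a assume \<phi>: "\<phi> \<in> test_functions \<Omega>" and e: "e \<in> Basis"
  have i: "integrable (lebesgue_on \<Omega>) (\<lambda>x. (g x \<bullet> e) * \<phi> x)" "integrable (lebesgue_on \<Omega>) (\<lambda>x. (h x \<bullet> e) * \<phi> x)"
    by (intro continuous_mult_L2_integrable test_functionD(2)[OF \<phi>] L2_space_inner_right \<Omega> gh)+
  have j: "integrable (lebesgue_on \<Omega>) (\<lambda>x. v x * partial \<phi> e x)" "integrable (lebesgue_on \<Omega>) (\<lambda>x. w x * partial \<phi> e x)"
    by (intro continuous_mult_L2_integrable test_functionD(3)[OF \<phi> e] \<Omega> assms)+
  show "(LINT x|lebesgue_on \<Omega>. (v + w) x * partial \<phi> e x) = - (LINT x|lebesgue_on \<Omega>. (g + h) x \<bullet> e * \<phi> x)"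
    using assms(3,4) \<phi> e i j by (simp add: has_weak_gradient_def inner_add_left distrib_right)
qed

text \<open>This frees the later arguments from the choice in \<open>weak_grad\<close>: any weak
  gradient at hand may take its place up to a null set.\<close>

lemma weak_grad_AE_eq:
  "\<lbrakk>v \<in> L2_space \<Omega>; has_weak_gradient \<Omega> v g\<rbrakk> \<Longrightarrow> AE x in lebesgue_on \<Omega>. weak_grad \<Omega> v x = g x"
  using weak_gradient_unique H1_spaceD H1_spaceI by blast

lemma subspace_H1_space: "subspace (H1_space \<Omega>)"
proof (rule subspaceI)
  have "has_weak_gradient \<Omega> 0 0" using L2.mem(4) by (simp add: has_weak_gradient_def)
  then show "0 \<in> H1_space \<Omega>" using H1_spaceI L2.mem(4) by blast
  show "v + w \<in> H1_space \<Omega>" if "v \<in> H1_space \<Omega>" "w \<in> H1_space \<Omega>" for v w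
    using has_weak_gradient_add[OF H1_spaceD(1)[OF that(1)] H1_spaceD(1)[OF that(2)] H1_spaceD(2)[OF that(1)] H1_spaceD(2)[OF that(2)]]
      L2.mem(1)[OF H1_spaceD(1)[OF that(1)] H1_spaceD(1)[OF that(2)]] H1_spaceI by blast
  show "c *\<^sub>R v \<in> H1_space \<Omega>" if "v \<in> H1_space \<Omega>" for c v
    using has_weak_gradient_scaleR[OF H1_spaceD(2)[OF that], of c] L2.mem(3)[OF H1_spaceD(1)[OF that], of c] H1_spaceI by blast
qed

lemma weak_grad_add:
  assumes "v \<in> H1_space \<Omega>" "w \<in> H1_space \<Omega>"
  shows "AE x in lebesgue_on \<Omega>. weak_grad \<Omega> (v + w) x = weak_grad \<Omega> v x + weak_grad \<Omega> w x"
  using weak_grad_AE_eq[OF L2.mem(1) has_weak_gradient_add] assms[THEN H1_spaceD(1)] assms[THEN H1_spaceD(2)]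
  by simp

lemma weak_grad_scaleR:
  assumes "v \<in> H1_space \<Omega>"
  shows "AE x in lebesgue_on \<Omega>. weak_grad \<Omega> (c *\<^sub>R v) x = c *\<^sub>R weak_grad \<Omega> v x"
  using weak_grad_AE_eq[OF L2.mem(3)[OF H1_spaceD(1)[OF assms]] has_weak_gradient_scaleR[OF H1_spaceD(2)[OF assms]]]
  by simp

lemma semi_inner_gradient: "semi_inner (H1_space \<Omega>) (\<lambda>v w. L2_inner \<Omega> (weak_grad \<Omega> v) (weak_grad \<Omega> w))"
  by (rule semi_inner_L2_pullback)
     (simp_all add: subspace_H1_space H1_spaceD weak_grad_add weak_grad_scaleR)

lemmas grad_norm_triangle = semi_inner.triangle[OF semi_inner_gradient, folded norm_L2_def, folded grad_norm_def]
lemmas grad_norm_scale = semi_inner.norm_scale[OF semi_inner_gradient, folded norm_L2_def, folded grad_norm_def]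

text \<open>The factor 2 is the price of passing through the sum of the two norms; closedness of
  \<open>H10_space\<close> under addition asks for no better constant.\<close>

lemma norm_H1_add_le:
  assumes "v \<in> H1_space \<Omega>" "w \<in> H1_space \<Omega>"
  shows "norm_H1 \<Omega> (v + w) \<le> 2 * (norm_H1 \<Omega> v + norm_H1 \<Omega> w)"
proof -
  have "norm_H1 \<Omega> (v + w) \<le> norm_L2 \<Omega> (v + w) + grad_norm \<Omega> (v + w)" by (rule norm_H1_le_sum)
  also have "\<dots> \<le> (norm_L2 \<Omega> v + norm_L2 \<Omega> w) + (grad_norm \<Omega> v + grad_norm \<Omega> w)"
    by (intro add_mono norm_L2_triangle grad_norm_triangle assms H1_spaceD)
  also have "\<dots> \<le> (norm_H1 \<Omega> v + norm_H1 \<Omega> w) + (norm_H1 \<Omega> v + norm_H1 \<Omega> w)"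
    by (intro add_mono norm_L2_le_norm_H1 grad_norm_le_norm_H1)
  finally show ?thesis by simp
qed

lemma test_function_H1: "\<phi> \<in> test_functions \<Omega> \<Longrightarrow> \<phi> \<in> H1_space \<Omega>"
  using H1_spaceI test_function_L2 test_function_has_weak_gradient[OF \<Omega>] by blast

lemma norm_H1_scale: "v \<in> H1_space \<Omega> \<Longrightarrow> norm_H1 \<Omega> (c *\<^sub>R v) = \<bar>c\<bar> * norm_H1 \<Omega> v"
  using norm_L2_scale[OF H1_spaceD(1)[of v \<Omega>], of c] grad_norm_scale[of v c]
  by (simp add: norm_H1_def grad_norm_def power_mult_distrib real_sqrt_mult flip: distrib_left)

lemma subspace_H10_space: "subspace (H10_space \<Omega>)"
proof (rule subspaceI)
  \<comment> \<open>Homogeneity with factor 0 gives this without identifying the gradient chosen for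
    the zero function.\<close>
  have "norm_H1 \<Omega> (0 - 0) = 0"
    using norm_H1_scale[OF subspace_0[OF subspace_H1_space], of 0] by simp
  then show "0 \<in> H10_space \<Omega>"
    using subspace_0[OF subspace_H1_space] subspace_0[OF subspace_test_functions]
    unfolding H10_space_iff by (metis (no_types, lifting))
next
  fix v w assume v: "v \<in> H10_space \<Omega>" and w: "w \<in> H10_space \<Omega>"
  have "\<exists>\<phi>\<in>test_functions \<Omega>. norm_H1 \<Omega> (v + w - \<phi>) < \<epsilon>" if "\<epsilon> > 0" for \<epsilon>
  proof -
    \<comment> \<open>Two approximation errors, each doubled by
      \<open>norm_H1_add_le\<close>.\<close>
    have "\<epsilon> / 4 > 0" using that by simp
    then obtain \<phi> \<psi> where t: "\<phi> \<in> test_functions \<Omega>" "norm_H1 \<Omega> (v - \<phi>) < \<epsilon> / 4"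
      "\<psi> \<in> test_functions \<Omega>" "norm_H1 \<Omega> (w - \<psi>) < \<epsilon> / 4"
      using v w unfolding H10_space_iff by blast
    have "norm_H1 \<Omega> (v + w - (\<phi> + \<psi>)) = norm_H1 \<Omega> ((v - \<phi>) + (w - \<psi>))" by (simp add: algebra_simps)
    also have "\<dots> \<le> 2 * (norm_H1 \<Omega> (v - \<phi>) + norm_H1 \<Omega> (w - \<psi>))"
      by (intro norm_H1_add_le subspace_diff[OF subspace_H1_space] H10_H1 v w test_function_H1 t)
    also have "\<dots> < \<epsilon>" using t by simp
    finally show ?thesis using subspace_add[OF subspace_test_functions t(1,3)] by blast
  qed
  then show "v + w \<in> H10_space \<Omega>"
    using H10_H1[OF v] H10_H1[OF w] subspace_add[OF subspace_H1_space] unfolding H10_space_iff by blast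
next
  fix c v assume v: "v \<in> H10_space \<Omega>"
  have "\<exists>\<phi>\<in>test_functions \<Omega>. norm_H1 \<Omega> (c *\<^sub>R v - \<phi>) < \<epsilon>" if "\<epsilon> > 0" for \<epsilon>
  proof -
    \<comment> \<open>The \<open>+ 1\<close> admits \<open>c = 0\<close> and makes the final
      estimate strict.\<close>
    have pos: "\<epsilon> / (\<bar>c\<bar> + 1) > 0" using that by (simp add: add_nonneg_pos)
    then obtain \<phi> where t: "\<phi> \<in> test_functions \<Omega>" "norm_H1 \<Omega> (v - \<phi>) < \<epsilon> / (\<bar>c\<bar> + 1)"
      using v unfolding H10_space_iff by blast
    have "norm_H1 \<Omega> (c *\<^sub>R v - c *\<^sub>R \<phi>) = norm_H1 \<Omega> (c *\<^sub>R (v - \<phi>))" by (simp add: scaleR_diff_right)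
    also have "\<dots> = \<bar>c\<bar> * norm_H1 \<Omega> (v - \<phi>)"
      by (intro norm_H1_scale subspace_diff[OF subspace_H1_space] H10_H1 v test_function_H1 t)
    also have "\<dots> \<le> \<bar>c\<bar> * (\<epsilon> / (\<bar>c\<bar> + 1))" using t by (intro mult_left_mono) auto
    also have "\<dots> < \<epsilon>" using that by (simp add: field_simps)
    finally show ?thesis using subspace_scale[OF subspace_test_functions t(1)] by blast
  qed
  then show "c *\<^sub>R v \<in> H10_space \<Omega>"
    using H10_H1[OF v] subspace_scale[OF subspace_H1_space] unfolding H10_space_iff by blast
qed

text \<open>Test functions are dense in \<open>H10_space\<close>, and both sides are continuous with
  respect to the norm of that density.\<close>

lemma Poincare:
  assumes R: "\<And>x. x \<in> \<Omega> \<Longrightarrow> norm x \<le> R" "R > 0" and v: "v \<in> H10_space \<Omega>"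
  shows "norm_L2 \<Omega> v \<le> 2 * R * grad_norm \<Omega> v"
proof (rule field_le_epsilon)
  fix \<epsilon> :: real assume "\<epsilon> > 0"
  \<comment> \<open>The distance \<delta> to the test function enters once through the L2 norm and
    with factor \<open>2 * R\<close> through the gradient.\<close>
  then have "\<epsilon> / (1 + 2 * R) > 0" using R(2) by simp
  then obtain \<phi> where t: "\<phi> \<in> test_functions \<Omega>" "norm_H1 \<Omega> (v - \<phi>) < \<epsilon> / (1 + 2 * R)"
    using v unfolding H10_space_iff by blast
  define \<delta> where "\<delta> = norm_H1 \<Omega> (v - \<phi>)"
  have H1: "v \<in> H1_space \<Omega>" "\<phi> \<in> H1_space \<Omega>" "v - \<phi> \<in> H1_space \<Omega>" "\<phi> - v \<in> H1_space \<Omega>"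
    by (intro subspace_diff[OF subspace_H1_space] H10_H1 v test_function_H1 t)+
  have "norm_L2 \<Omega> v = norm_L2 \<Omega> ((v - \<phi>) + \<phi>)" by simp
  also have "\<dots> \<le> norm_L2 \<Omega> (v - \<phi>) + norm_L2 \<Omega> \<phi>" by (intro norm_L2_triangle H1_spaceD H1)
  also have "\<dots> \<le> \<delta> + norm_L2 \<Omega> \<phi>" using norm_L2_le_norm_H1 by (simp add: \<delta>_def)
  also have "norm_L2 \<Omega> \<phi> \<le> 2 * R * norm_L2 \<Omega> (grad \<phi>)"
    by (rule Poincare_test_function[OF \<Omega> R t(1)])
  also have "norm_L2 \<Omega> (grad \<phi>) = grad_norm \<Omega> \<phi>"
    unfolding grad_norm_def
  proof (rule norm_L2_cong_AE[symmetric])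
    show "AE x in lebesgue_on \<Omega>. weak_grad \<Omega> \<phi> x = grad \<phi> x"
      by (intro weak_grad_AE_eq test_function_L2 test_function_has_weak_gradient \<Omega> t)
  qed (use H1_spaceD(3)[OF H1(2)] has_weak_gradient_L2 test_function_has_weak_gradient[OF \<Omega> t(1)] in blast)+
  also have "grad_norm \<Omega> \<phi> \<le> grad_norm \<Omega> v + \<delta>"
  proof -
    have "grad_norm \<Omega> \<phi> \<le> grad_norm \<Omega> (\<phi> - v) + grad_norm \<Omega> v"
      using grad_norm_triangle[OF H1(4,1)] by simp
    also have "grad_norm \<Omega> (\<phi> - v) = grad_norm \<Omega> (v - \<phi>)"
      using grad_norm_scale[OF H1(3), of "-1"] by simp
    also have "\<dots> \<le> \<delta>" using grad_norm_le_norm_H1 by (simp add: \<delta>_def)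
    finally show ?thesis by simp
  qed
  finally have "norm_L2 \<Omega> v \<le> \<delta> + 2 * R * (grad_norm \<Omega> v + \<delta>)" using R(2) by simp
  also have "\<dots> = 2 * R * grad_norm \<Omega> v + (1 + 2 * R) * \<delta>" by (simp add: algebra_simps)
  also have "(1 + 2 * R) * \<delta> \<le> \<epsilon>" using t(2) R(2) by (simp add: \<delta>_def field_simps)
  finally show "norm_L2 \<Omega> v \<le> 2 * R * grad_norm \<Omega> v + \<epsilon>" by simp
qed

end

subsection \<open>The bilinear form\<close>

lemma semi_inner_sum:
  assumes "semi_inner E B" "semi_inner E B'"
  shows "semi_inner E (\<lambda>x y. B x y + B' x y)"
proof -
  interpret B: semi_inner E B by fact
  interpret B': semi_inner E B' by fact
  show ?thesis
    by standard (simp_all add: B.sub B.sym B'.sym B.add_left B'.add_left B.scale_left B'.scale_left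
        B.nonneg B'.nonneg distrib_left)
qed

lemma linear_term_zero:
  fixes a b :: real
  assumes "\<And>t. 0 \<le> t * a + t\<^sup>2 * b" "b \<ge> 0"
  shows "a = 0"
proof -
  \<comment> \<open>A step against the sign of \<open>a\<close>; \<open>b + 1\<close> keeps the
    denominator positive and turns the value into minus a square.\<close>
  have "0 \<le> (- a / (b + 1)) * a + (- a / (b + 1))\<^sup>2 * b" by (rule assms)
  also have "\<dots> = - (a / (b + 1))\<^sup>2"
    using assms(2) by (simp add: power2_eq_square divide_simps) (simp add: algebra_simps)
  finally show ?thesis using assms(2) by simp
qed

section \<open>Finite generation modulo null functions\<close>

lemma subspace_Times: "subspace A \<Longrightarrow> subspace B \<Longrightarrow> subspace (A \<times> B)"
  by (auto simp: subspace_def zero_prod_def)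

lemma subspace_null: "subspace {v :: 'a::euclidean_space \<Rightarrow> 'b::real_vector. AE x in lebesgue_on \<Omega>. v x = 0}"
proof (rule subspaceI)
  fix v w :: "'a \<Rightarrow> 'b"
  assume "v \<in> {v. AE x in lebesgue_on \<Omega>. v x = 0}" "w \<in> {v. AE x in lebesgue_on \<Omega>. v x = 0}"
  then have "AE x in lebesgue_on \<Omega>. v x = 0" "AE x in lebesgue_on \<Omega>. w x = 0" by simp_all
  then have "AE x in lebesgue_on \<Omega>. (v + w) x = 0" by eventually_elim simp
  then show "v + w \<in> {v. AE x in lebesgue_on \<Omega>. v x = 0}" by simp
qed auto

text \<open>Substitute for finite dimension. The generators may lie outside \<open>X\<close>: for
  \<open>V_h\<close> they are polynomials cut off to one element, which in general jump across its
  boundary.\<close>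

definition finitely_generated ::
    "'a::euclidean_space set \<Rightarrow> ('a \<Rightarrow> 'b::real_vector) set \<Rightarrow> bool" where
  "finitely_generated \<Omega> X \<longleftrightarrow>
     (\<exists>S. finite S \<and> (\<forall>v\<in>X. \<exists>s\<in>span S. AE x in lebesgue_on \<Omega>. v x = s x))"

text \<open>The generators are embedded as pairs with one zero component, and the deviations from
  the span are collected in a null pair, which is the form that \<open>exists_projection\<close>
  expects.\<close>

lemma finitely_generated_Times:
  fixes V :: "('a::euclidean_space \<Rightarrow> 'b::real_vector) set" and W :: "('a \<Rightarrow> 'c::real_vector) set"
  assumes "finitely_generated \<Omega> V" "finitely_generated \<Omega> W"
  obtains S where "finite S" "V \<times> W \<subseteq> {s + n |s n. s \<in> span S \<and>
      n \<in> {v. AE x in lebesgue_on \<Omega>. v x = 0} \<times> {v. AE x in lebesgue_on \<Omega>. v x = 0}}"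
proof -
  obtain S S' where S: "finite S" "\<And>v. v \<in> V \<Longrightarrow> \<exists>s\<in>span S. AE x in lebesgue_on \<Omega>. v x = s x"
    and S': "finite S'" "\<And>v. v \<in> W \<Longrightarrow> \<exists>s\<in>span S'. AE x in lebesgue_on \<Omega>. v x = s x"
    using assms unfolding finitely_generated_def by metis
  define i1 :: "('a \<Rightarrow> 'b) \<Rightarrow> ('a \<Rightarrow> 'b) \<times> ('a \<Rightarrow> 'c)" where "i1 = (\<lambda>f. (f, 0))"
  define i2 :: "('a \<Rightarrow> 'c) \<Rightarrow> ('a \<Rightarrow> 'b) \<times> ('a \<Rightarrow> 'c)" where "i2 = (\<lambda>f. (0, f))"
  have lin: "linear i1" "linear i2" by (auto intro!: linearI simp: i1_def i2_def)
  show thesis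
  proof (rule that[of "i1 ` S \<union> i2 ` S'"], goal_cases)
    case 2
    show ?case
    proof (clarify, goal_cases)
      case (1 v \<tau>)
      obtain s where s: "s \<in> span S" "AE x in lebesgue_on \<Omega>. v x = s x" using S 1 by blast
      obtain s' where s': "s' \<in> span S'" "AE x in lebesgue_on \<Omega>. \<tau> x = s' x" using S' 1 by blast
      have "i1 s + i2 s' \<in> span (i1 ` S \<union> i2 ` S')"
      proof (rule span_add)
        show "i1 s \<in> span (i1 ` S \<union> i2 ` S')"
          using linear_span_image[OF lin(1), of S] s(1) span_mono[of "i1 ` S" "i1 ` S \<union> i2 ` S'"] by blast
        show "i2 s' \<in> span (i1 ` S \<union> i2 ` S')"
          using linear_span_image[OF lin(2), of S'] s'(1) span_mono[of "i2 ` S'" "i1 ` S \<union> i2 ` S'"] by blast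
      qed
      moreover have "(v, \<tau>) = (i1 s + i2 s') + (v - s, \<tau> - s')" by (simp add: i1_def i2_def)
      moreover have "(v - s, \<tau> - s') \<in> {v. AE x in lebesgue_on \<Omega>. v x = 0} \<times> {v. AE x in lebesgue_on \<Omega>. v x = 0}"
        using s(2) s'(2) by simp
      ultimately show ?case by blast
    qed
  qed (use S S' in simp)
qed

declare bilinear_a.simps [simp del]

context
  fixes \<Omega> :: "'a::euclidean_space set"
  assumes \<Omega>: "open \<Omega>" "bounded \<Omega>"
begin

text \<open>The form is the sum of two pullbacks of the L2 inner product, along the maps to \<tau>
  and to \<tau> - 2\<nabla>v.\<close>

lemma semi_inner_bilinear_a: "semi_inner (H10_space \<Omega> \<times> L2_space \<Omega>) (bilinear_a \<Omega>)"
proof -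
  let ?E = "H10_space \<Omega> \<times> (L2_space \<Omega> :: ('a \<Rightarrow> 'a) set)"
  let ?T = "\<lambda>p x. snd p x - 2 *\<^sub>R weak_grad \<Omega> (fst p) x"
  have sub: "subspace ?E" by (intro subspace_Times subspace_H10_space[OF \<Omega>] subspace_L2_space)
  have 1: "semi_inner ?E (\<lambda>p q. L2_inner \<Omega> (snd p) (snd q))"
    by (rule semi_inner_L2_pullback[OF sub]) auto
  have 2: "semi_inner ?E (\<lambda>p q. L2_inner \<Omega> (?T p) (?T q))"
  proof (rule semi_inner_L2_pullback[OF sub])
    show "?T p \<in> L2_space \<Omega>" if "p \<in> ?E" for p
    proof -
      have "snd p - 2 *\<^sub>R weak_grad \<Omega> (fst p) \<in> L2_space \<Omega>"
        using that by (auto intro!: L2.mem H1_spaceD(3) H10_H1)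
      then show ?thesis by (simp add: fun_diff_def)
    qed
    show "AE z in lebesgue_on \<Omega>. ?T (p + q) z = ?T p z + ?T q z" if "p \<in> ?E" "q \<in> ?E" for p q
    proof -
      have "AE z in lebesgue_on \<Omega>. weak_grad \<Omega> (fst p + fst q) z = weak_grad \<Omega> (fst p) z + weak_grad \<Omega> (fst q) z"
        using that by (intro weak_grad_add[OF \<Omega>] H10_H1) auto
      then show ?thesis by eventually_elim (simp add: algebra_simps)
    qed
    show "AE z in lebesgue_on \<Omega>. ?T (c *\<^sub>R p) z = c *\<^sub>R ?T p z" if "p \<in> ?E" for c p
    proof -
      have "AE z in lebesgue_on \<Omega>. weak_grad \<Omega> (c *\<^sub>R fst p) z = c *\<^sub>R weak_grad \<Omega> (fst p) z"
        using that by (intro weak_grad_scaleR[OF \<Omega>] H10_H1) auto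
      then show ?thesis by eventually_elim (simp add: algebra_simps)
    qed
  qed
  have "bilinear_a \<Omega> = (\<lambda>p q. L2_inner \<Omega> (snd p) (snd q) + L2_inner \<Omega> (?T p) (?T q))"
    by (auto simp: fun_eq_iff bilinear_a.simps)
  then show ?thesis using semi_inner_sum[OF 1 2] by simp
qed

interpretation A: semi_inner "H10_space \<Omega> \<times> L2_space \<Omega>" "bilinear_a \<Omega>"
  by (rule semi_inner_bilinear_a)

lemma bilinear_a_eq:
  "bilinear_a \<Omega> (u, \<sigma>) (v, \<tau>) =
     L2_inner \<Omega> \<sigma> \<tau> + L2_inner \<Omega> (\<sigma> - 2 *\<^sub>R weak_grad \<Omega> u) (\<tau> - 2 *\<^sub>R weak_grad \<Omega> v)"
  by (simp add: bilinear_a.simps fun_diff_def scaleR_fun_def)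

lemma bilinear_a_diag:
  "bilinear_a \<Omega> (v, \<tau>) (v, \<tau>) = (norm_L2 \<Omega> \<tau>)\<^sup>2 + (norm_L2 \<Omega> (\<tau> - 2 *\<^sub>R weak_grad \<Omega> v))\<^sup>2"
  by (simp only: bilinear_a_eq norm_L2_power2)

text \<open>The form measures \<tau> and \<tau> - 2\<nabla>v. Their difference is 2\<nabla>v, so its
  norm is at most twice the energy norm.\<close>

lemma energy_norm_lower:
  assumes "v \<in> H10_space \<Omega>" "\<tau> \<in> L2_space \<Omega>"
  shows "norm_L2 \<Omega> \<tau> \<le> sqrt (bilinear_a \<Omega> (v, \<tau>) (v, \<tau>))"
    and "grad_norm \<Omega> v \<le> sqrt (bilinear_a \<Omega> (v, \<tau>) (v, \<tau>))"
proof -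
  let ?q = "sqrt (bilinear_a \<Omega> (v, \<tau>) (v, \<tau>))" and ?g = "weak_grad \<Omega> v"
  have g: "?g \<in> L2_space \<Omega>" by (intro H1_spaceD H10_H1 assms)
  show 1: "norm_L2 \<Omega> \<tau> \<le> ?q" unfolding bilinear_a_diag by (rule real_sqrt_sum_squares_ge1)
  have 2: "norm_L2 \<Omega> (\<tau> - 2 *\<^sub>R ?g) \<le> ?q" unfolding bilinear_a_diag by (rule real_sqrt_sum_squares_ge2)
  have "2 * norm_L2 \<Omega> ?g = norm_L2 \<Omega> (2 *\<^sub>R ?g)" using norm_L2_scale[OF g, of 2] by simp
  also have "\<dots> = norm_L2 \<Omega> (\<tau> - (\<tau> - 2 *\<^sub>R ?g))" by simp
  also have "\<dots> \<le> norm_L2 \<Omega> \<tau> + norm_L2 \<Omega> (\<tau> - 2 *\<^sub>R ?g)"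
    by (intro norm_L2_triangle_diff L2.mem assms g)
  finally show "grad_norm \<Omega> v \<le> ?q" using 1 2 by (simp add: grad_norm_def)
qed

lemma energy_norm_upper:
  assumes "v \<in> H10_space \<Omega>" "\<tau> \<in> L2_space \<Omega>"
  shows "sqrt (bilinear_a \<Omega> (v, \<tau>) (v, \<tau>)) \<le> 2 * (norm_L2 \<Omega> \<tau> + grad_norm \<Omega> v)"
proof -
  let ?g = "weak_grad \<Omega> v"
  have g: "?g \<in> L2_space \<Omega>" by (intro H1_spaceD H10_H1 assms)
  have "sqrt (bilinear_a \<Omega> (v, \<tau>) (v, \<tau>)) \<le> norm_L2 \<Omega> \<tau> + norm_L2 \<Omega> (\<tau> - 2 *\<^sub>R ?g)"
    unfolding bilinear_a_diag by (rule sqrt_sum_squares_le_sum) simp_all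
  also have "norm_L2 \<Omega> (\<tau> - 2 *\<^sub>R ?g) \<le> norm_L2 \<Omega> \<tau> + norm_L2 \<Omega> (2 *\<^sub>R ?g)"
    by (intro norm_L2_triangle_diff L2.mem assms g)
  also have "norm_L2 \<Omega> (2 *\<^sub>R ?g) = 2 * grad_norm \<Omega> v"
    using norm_L2_scale[OF g, of 2] by (simp add: grad_norm_def)
  finally show ?thesis by simp
qed

text \<open>Along \<open>u + t *\<^sub>R v\<close> the energy is a quadratic polynomial in
  \<open>t\<close> that is minimal at 0, so its linear coefficient vanishes.\<close>

lemma Euler_Lagrange:
  assumes ell: "ell \<in> H_minus1 \<Omega>" and u: "u \<in> H10_space \<Omega>"
    and min: "\<And>v. v \<in> H10_space \<Omega> \<Longrightarrow> energy \<Omega> ell u \<le> energy \<Omega> ell v"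
    and v: "v \<in> H10_space \<Omega>"
  shows "L2_inner \<Omega> (weak_grad \<Omega> u) (weak_grad \<Omega> v) = ell v"
proof -
  interpret G: semi_inner "H1_space \<Omega>" "\<lambda>v w. L2_inner \<Omega> (weak_grad \<Omega> v) (weak_grad \<Omega> w)"
    by (rule semi_inner_gradient[OF \<Omega>])
  let ?G = "\<lambda>v w. L2_inner \<Omega> (weak_grad \<Omega> v) (weak_grad \<Omega> w)"
  have en: "energy \<Omega> ell w = 1/2 * ?G w w - ell w" for w
    by (simp add: energy_def L2_inner_def power2_norm_eq_inner)
  have H1: "u \<in> H1_space \<Omega>" "v \<in> H1_space \<Omega>" using u v H10_H1 by auto
  have "0 \<le> t * (?G u v - ell v) + t\<^sup>2 * (?G v v / 2)" for t
  proof -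
    have "ell (\<lambda>x. 1 * u x + t * v x) = 1 * ell u + t * ell v"
      using ell u v unfolding H_minus1_def by blast
    moreover have "(\<lambda>x. 1 * u x + t * v x) = u + t *\<^sub>R v" by (simp add: fun_eq_iff)
    ultimately have l: "ell (u + t *\<^sub>R v) = ell u + t * ell v" by simp
    have "energy \<Omega> ell u \<le> energy \<Omega> ell (u + t *\<^sub>R v)"
      by (intro min subspace_add[OF subspace_H10_space[OF \<Omega>]] subspace_scale[OF subspace_H10_space[OF \<Omega>]] u v)
    then show ?thesis unfolding en l G.expand[OF H1] by (simp add: algebra_simps)
  qed
  moreover have "?G v v / 2 \<ge> 0" using G.nonneg[OF H1(2)] by simp
  ultimately have "?G u v - ell v = 0" by (rule linear_term_zero)
  then show ?thesis by simp
qed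

text \<open>Almost everywhere \<sigma> - 2\<nabla>u = -\<sigma>. The two products of \<sigma> with
  \<tau> cancel, and twice the product of \<sigma> with \<nabla>v remains.\<close>

lemma bilinear_a_exact:
  assumes EL: "L2_inner \<Omega> (weak_grad \<Omega> u) (weak_grad \<Omega> v) = ell v"
    and u: "u \<in> H10_space \<Omega>" and \<sigma>: "has_weak_gradient \<Omega> u \<sigma>"
    and v: "v \<in> H10_space \<Omega>" and \<tau>: "\<tau> \<in> L2_space \<Omega>"
  shows "bilinear_a \<Omega> (u, \<sigma>) (v, \<tau>) = 2 * ell v"
proof -
  have gu: "weak_grad \<Omega> u \<in> L2_space \<Omega>" and gv: "weak_grad \<Omega> v \<in> L2_space \<Omega>"
    using H1_spaceD(3) H10_H1 u v by auto
  have s: "\<sigma> \<in> L2_space \<Omega>" using has_weak_gradient_L2[OF \<sigma>] .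
  have ae: "AE x in lebesgue_on \<Omega>. weak_grad \<Omega> u x = \<sigma> x"
    using weak_grad_AE_eq[OF \<Omega> H1_spaceD(1)[OF H10_H1[OF u]] \<sigma>] .
  have "L2_inner \<Omega> (\<sigma> - 2 *\<^sub>R weak_grad \<Omega> u) (\<tau> - 2 *\<^sub>R weak_grad \<Omega> v)
      = L2_inner \<Omega> ((-1) *\<^sub>R \<sigma>) (\<tau> - 2 *\<^sub>R weak_grad \<Omega> v)"
  proof (rule L2_inner_cong_AE)
    show "AE x in lebesgue_on \<Omega>. (\<sigma> - 2 *\<^sub>R weak_grad \<Omega> u) x = ((-1) *\<^sub>R \<sigma>) x"
      using ae by eventually_elim (simp add: scaleR_2)
  qed (intro L2.mem s gu gv \<tau> AE_I2 refl)+
  also have "\<dots> = - L2_inner \<Omega> \<sigma> \<tau> + 2 * L2_inner \<Omega> \<sigma> (weak_grad \<Omega> v)"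
    using s \<tau> gv by (simp only: L2.bilin L2.mem)
  also have "L2_inner \<Omega> \<sigma> (weak_grad \<Omega> v) = ell v"
    using L2_inner_cong_AE[OF ae _ gu gv s gv] EL by simp
  finally show ?thesis by (simp only: bilinear_a_eq)
qed

end

subsection \<open>Finite element spaces\<close>

lemma sum_fun_apply: "(\<Sum>i\<in>A. f i) x = (\<Sum>i\<in>A. f i x)"
  by (induction A rule: infinite_finite_induct) auto

text \<open>The local space depends on the element, which covers the mapped polynomials of
  \<open>V_h\<close> as well as the physical ones of \<open>L_h\<close>.\<close>

definition piecewise ::
    "'a::euclidean_space set set \<Rightarrow> ('a set \<Rightarrow> ('a \<Rightarrow> 'b::real_vector) set) \<Rightarrow> ('a \<Rightarrow> 'b) set" where
  "piecewise \<T> P = {v. \<forall>T\<in>\<T>. \<exists>p\<in>P T. AE x in lebesgue_on T. v x = p x}"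

lemma subspace_piecewise:
  assumes "\<And>T. T \<in> \<T> \<Longrightarrow> subspace (P T)"
  shows "subspace (piecewise \<T> P)"
proof (rule subspaceI)
  have "\<exists>p\<in>P T. AE x in lebesgue_on T. 0 x = p x" if "T \<in> \<T>" for T
    using subspace_0[OF assms[OF that]] by (intro bexI[of _ 0]) auto
  then show "0 \<in> piecewise \<T> P" by (simp add: piecewise_def)
next
  fix v w assume vw: "v \<in> piecewise \<T> P" "w \<in> piecewise \<T> P"
  have "\<exists>p\<in>P T. AE x in lebesgue_on T. (v + w) x = p x" if T: "T \<in> \<T>" for T
  proof -
    obtain p q where pq: "p \<in> P T" "q \<in> P T"
      "AE x in lebesgue_on T. v x = p x" "AE x in lebesgue_on T. w x = q x"
      using vw T unfolding piecewise_def by blast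
    have "AE x in lebesgue_on T. (v + w) x = (p + q) x" using pq(3,4) by eventually_elim simp
    then show ?thesis using subspace_add[OF assms[OF T] pq(1,2)] by blast
  qed
  then show "v + w \<in> piecewise \<T> P" unfolding piecewise_def by blast
next
  fix c v assume v: "v \<in> piecewise \<T> P"
  have "\<exists>p\<in>P T. AE x in lebesgue_on T. (c *\<^sub>R v) x = p x" if T: "T \<in> \<T>" for T
  proof -
    obtain p where p: "p \<in> P T" "AE x in lebesgue_on T. v x = p x"
      using v T unfolding piecewise_def by blast
    have "AE x in lebesgue_on T. (c *\<^sub>R v) x = (c *\<^sub>R p) x" using p(2) by eventually_elim simp
    then show ?thesis using subspace_scale[OF assms[OF T] p(1)] by blast
  qed
  then show "c *\<^sub>R v \<in> piecewise \<T> P" unfolding piecewise_def by blast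
qed

lemma finitely_generated_mono: "finitely_generated \<Omega> Y \<Longrightarrow> X \<subseteq> Y \<Longrightarrow> finitely_generated \<Omega> X"
  unfolding finitely_generated_def by blast

text \<open>Local generators are multiplied by the indicator of their element. Outside the null set
  of element boundaries each point of \<open>\<Omega>\<close> lies in exactly one element, so the
  sum of the cut-off local pieces recovers \<open>v\<close>.\<close>

lemma finitely_generated_piecewise:
  fixes \<T> :: "'a::euclidean_space set set" and P :: "'a set \<Rightarrow> ('a \<Rightarrow> 'b::real_vector) set"
  assumes fin: "finite \<T>" and disj: "disjoint \<T>" and cover: "\<Omega> \<subseteq> (\<Union>T\<in>\<T>. closure T)"
    and \<Omega>: "\<Omega> \<in> sets lebesgue"
    and T: "\<And>T. T \<in> \<T> \<Longrightarrow> T \<in> sets lebesgue" "\<And>T. T \<in> \<T> \<Longrightarrow> negligible (closure T - T)"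
    and P: "\<And>T. T \<in> \<T> \<Longrightarrow> \<exists>S. finite S \<and> P T \<subseteq> span S"
  shows "finitely_generated \<Omega> (piecewise \<T> P)"
proof -
  obtain S where S: "\<And>T. T \<in> \<T> \<Longrightarrow> finite (S T)" "\<And>T. T \<in> \<T> \<Longrightarrow> P T \<subseteq> span (S T)"
    using P by metis
  define r :: "'a set \<Rightarrow> ('a \<Rightarrow> 'b) \<Rightarrow> 'a \<Rightarrow> 'b" where "r T f = (\<lambda>x. indicator T x *\<^sub>R f x)" for T f
  have lin: "linear (r T)" for T
    by (rule linearI) (auto simp: r_def fun_eq_iff scaleR_add_right)
  let ?S = "\<Union>T\<in>\<T>. r T ` S T"
  have "\<exists>s\<in>span ?S. AE x in lebesgue_on \<Omega>. v x = s x" if v: "v \<in> piecewise \<T> P" for v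
  proof -
    have "\<forall>T\<in>\<T>. \<exists>p. p \<in> P T \<and> (AE x in lebesgue_on T. v x = p x)"
      using v unfolding piecewise_def by blast
    from bchoice[OF this] obtain p where p: "\<And>T. T \<in> \<T> \<Longrightarrow> p T \<in> P T"
      "\<And>T. T \<in> \<T> \<Longrightarrow> AE x in lebesgue_on T. v x = p T x" by blast
    let ?s = "\<Sum>T\<in>\<T>. r T (p T)"
    have "?s \<in> span ?S"
    proof (rule span_sum)
      fix T assume "T \<in> \<T>"
      then have "r T (p T) \<in> span (r T ` S T)" using linear_span_image[OF lin, of T "S T"] p(1) S(2) by blast
      then show "r T (p T) \<in> span ?S" using span_mono[of "r T ` S T" ?S] \<open>T \<in> \<T>\<close> by blast
    qed
    moreover have "AE x in lebesgue_on \<Omega>. v x = ?s x"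
    proof -
      have 1: "AE x in lebesgue. \<forall>T\<in>\<T>. x \<in> T \<longrightarrow> v x = p T x"
        using p(2) T(1) fin by (intro AE_finite_allI) (simp_all add: AE_restrict_space_iff)
      have 2: "AE x in lebesgue. \<forall>T\<in>\<T>. x \<notin> closure T - T"
        using T(2) fin by (intro AE_finite_allI AE_not_in) (simp_all add: negligible_iff_null_sets)
      have "AE x in lebesgue. x \<in> \<Omega> \<longrightarrow> v x = ?s x"
        using 1 2
      proof eventually_elim
        case (elim x)
        show ?case
        proof
          assume "x \<in> \<Omega>"
          then obtain T where T: "T \<in> \<T>" "x \<in> T" using cover elim(2) by blast
          have "r T' (p T') x = (if T' = T then p T x else 0)" if "T' \<in> \<T>" for T'
            using disj T that by (auto simp: r_def disjoint_def indicator_def)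
          then have "?s x = p T x" using fin T(1) by (simp add: sum_fun_apply)
          then show "v x = ?s x" using elim(1) T by simp
        qed
      qed
      then show ?thesis using \<Omega> by (simp add: AE_restrict_space_iff)
    qed
    ultimately show ?thesis by blast
  qed
  moreover have "finite ?S" using fin S(1) by simp
  ultimately show ?thesis unfolding finitely_generated_def by blast
qed

section \<open>Polynomials on the elements\<close>

definition monomial :: "('n \<Rightarrow> nat) \<Rightarrow> real ^ 'n \<Rightarrow> real" where
  "monomial \<alpha> x = (\<Prod>i\<in>UNIV. (x $ i) ^ \<alpha> i)"

lemma poly_space_eq:
  "poly_space K k = range (\<lambda>c. \<Sum>\<alpha>\<in>exponents K k. c \<alpha> *\<^sub>R monomial \<alpha>)"
  by (auto simp: poly_space_def fun_eq_iff sum_fun_apply monomial_def image_def)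

lemma subspace_poly_space: "subspace (poly_space K k)"
proof -
  have "linear (\<lambda>c. \<Sum>\<alpha>\<in>exponents K k. c \<alpha> *\<^sub>R (monomial \<alpha> :: real ^ 'n \<Rightarrow> real))"
    by (rule linearI) (simp_all add: scaleR_add_left sum.distrib scaleR_sum_right)
  then show ?thesis unfolding poly_space_eq by (rule linear_subspace_image) (rule subspace_UNIV)
qed

lemma finite_exponents: "finite (exponents K k :: ('n::finite \<Rightarrow> nat) set)"
proof -
  have "exponents K k \<subseteq> (PiE UNIV (\<lambda>_. {..k}) :: ('n \<Rightarrow> nat) set)"
  proof (cases K)
    case Simplex
    have "\<alpha> i \<le> k" if "sum \<alpha> UNIV \<le> k" for \<alpha> :: "'n \<Rightarrow> nat" and i
      using member_le_sum[of i UNIV \<alpha>] that by simp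
    then show ?thesis using Simplex by auto
  qed auto
  then show ?thesis by (rule finite_subset) (simp add: finite_PiE)
qed

text \<open>Composition with \<open>G\<close> is linear in \<open>p\<close>, so composed monomials
  generate. \<open>G\<close> is \<open>inv (F T)\<close> for \<open>V_h\<close> and the identity for
  \<open>L_h\<close>.\<close>

lemma poly_space_comp_span:
  "\<exists>S. finite S \<and> (\<lambda>p x. p (G x)) ` poly_space K k \<subseteq> span S"
proof (intro exI conjI)
  let ?S = "(\<lambda>\<alpha> x. monomial \<alpha> (G x)) ` exponents K k"
  show "finite ?S" by (simp add: finite_exponents)
  show "(\<lambda>p x. p (G x)) ` poly_space K k \<subseteq> span ?S"
  proof (clarsimp simp: poly_space_eq)
    fix c :: "('b \<Rightarrow> nat) \<Rightarrow> real"
    have "(\<lambda>x. (\<Sum>\<alpha>\<in>exponents K k. c \<alpha> *\<^sub>R monomial \<alpha>) (G x)) =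
        (\<Sum>\<alpha>\<in>exponents K k. c \<alpha> *\<^sub>R (\<lambda>x. monomial \<alpha> (G x)))"
      by (simp add: fun_eq_iff sum_fun_apply)
    also have "\<dots> \<in> span ?S" by (intro span_sum span_scale span_base) simp
    finally show "(\<lambda>x. (\<Sum>\<alpha>\<in>exponents K k. c \<alpha> *\<^sub>R monomial \<alpha>) (G x)) \<in> span ?S" .
  qed
qed

lemma subspace_poly_space_comp: "subspace ((\<lambda>p x. p (G x)) ` poly_space K k)"
  by (rule linear_subspace_image[OF _ subspace_poly_space]) (auto intro!: linearI simp: fun_eq_iff)

lemma convex_ref_element: "convex (ref_element K :: (real ^ 'n) set)"
proof -
  have *: "axis i 1 \<bullet> x = x $ i" "(\<chi> i. 1) \<bullet> x = sum (($) x) UNIV" for i and x :: "real ^ 'n"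
    by (simp add: inner_axis') (simp add: inner_vec_def)
  show ?thesis
  proof (cases K)
    case Simplex
    have "ref_element K = (\<Inter>i. {x :: real ^ 'n. axis i 1 \<bullet> x > 0}) \<inter> {x. (\<chi> i. 1) \<bullet> x < 1}"
      unfolding * using Simplex by auto
    then show ?thesis
      by (simp only:) (intro convex_Int convex_INT convex_halfspace_gt convex_halfspace_lt)
  next
    case Cube
    have "ref_element K = (\<Inter>i. {x :: real ^ 'n. axis i 1 \<bullet> x > 0}) \<inter> (\<Inter>i. {x. axis i 1 \<bullet> x < 1})"
      unfolding * using Cube by auto
    then show ?thesis
      by (simp only:) (intro convex_Int convex_INT convex_halfspace_gt convex_halfspace_lt)
  qed
qed

text \<open>An element is an affine image of a convex set, hence convex and bounded; this gives
  measurability and a negligible frontier.\<close>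

lemma affine_partition_elements:
  assumes "affine_partition \<Omega> K \<T> F" "bounded \<Omega>" "T \<in> \<T>"
  shows "T \<in> sets lebesgue" "negligible (closure T - T)"
proof -
  have "(\<exists>A b. invertible A \<and> F T = (\<lambda>x. A *v x + b)) \<and> T = F T ` ref_element K"
    using assms(1,3) unfolding affine_partition_def by blast
  then obtain A b where "F T = (\<lambda>x. A *v x + b)" "T = F T ` ref_element K" by blast
  then have T: "T = (\<lambda>x. A *v x + b) ` ref_element K" by simp
  have "T = (+) b ` ((*v) A ` ref_element K)" unfolding T by (auto simp: image_def add.commute)
  then have conv: "convex T" by (simp add: convex_translation convex_linear_image convex_ref_element)
  have "T \<subseteq> closure \<Omega>"
    using assms(1,3) closure_subset[of T] unfolding affine_partition_def by blast
  then have "bounded T" using assms(2) bounded_closure bounded_subset by blast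
  then show "T \<in> sets lebesgue" using measurable_convex[OF conv] by (simp add: fmeasurableD)
  show "negligible (closure T - T)"
    by (rule negligible_subset[OF negligible_convex_frontier[OF conv]])
       (use interior_subset in \<open>auto simp: frontier_def\<close>)
qed

section \<open>Vector-valued finite element spaces\<close>

lemma subspace_vector_valued: "subspace X \<Longrightarrow> subspace (vector_valued X)"
proof (rule subspaceI)
  assume X: "subspace X"
  show "0 \<in> vector_valued X"
    using subspace_0[OF X] by (simp add: vector_valued_def zero_fun_def)
  show "v + w \<in> vector_valued X" if "v \<in> vector_valued X" "w \<in> vector_valued X" for v w
    using that subspace_add[OF X] by (fastforce simp: vector_valued_def plus_fun_def)
  show "c *\<^sub>R v \<in> vector_valued X" if "v \<in> vector_valued X" for c v
    using that subspace_scale[OF X] by (fastforce simp: vector_valued_def scaleR_fun_def)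
qed

text \<open>Embedding of scalar functions as the \<open>i\<close>-th component. A vector field is
  the sum of its embedded components, so integrability and finite generation carry over from scalar
  spaces.\<close>

definition along :: "'n \<Rightarrow> (real ^ 'n \<Rightarrow> real) \<Rightarrow> real ^ 'n \<Rightarrow> real ^ 'n" where
  "along i f x = f x *\<^sub>R axis i 1"

lemma linear_along: "linear (along i)"
  by (rule linearI) (auto simp: along_def fun_eq_iff scaleR_add_left)

lemma sum_along: "(\<Sum>i\<in>UNIV. along i (\<lambda>x. \<tau> x $ i)) = \<tau>"
  by (simp add: fun_eq_iff sum_fun_apply along_def vec_eq_iff axis_def if_distrib cong: if_cong)

lemma along_L2: "f \<in> L2_space \<Omega> \<Longrightarrow> along i f \<in> L2_space \<Omega>"
  by (auto simp: L2_space_iff along_def[abs_def])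

lemma vector_valued_L2: "X \<subseteq> L2_space \<Omega> \<Longrightarrow> vector_valued X \<subseteq> L2_space \<Omega>"
proof
  fix \<tau> assume "X \<subseteq> L2_space \<Omega>" "\<tau> \<in> vector_valued X"
  then have "(\<Sum>i\<in>UNIV. along i (\<lambda>x. \<tau> x $ i)) \<in> L2_space \<Omega>"
    by (intro subspace_sum[OF subspace_L2_space] along_L2) (auto simp: vector_valued_def)
  then show "\<tau> \<in> L2_space \<Omega>" by (simp add: sum_along)
qed

lemma finitely_generated_vector_valued:
  assumes "finitely_generated \<Omega> X"
  shows "finitely_generated \<Omega> (vector_valued X)"
proof -
  obtain S where S: "finite S" "\<And>v. v \<in> X \<Longrightarrow> \<exists>s\<in>span S. AE x in lebesgue_on \<Omega>. v x = s x"
    using assms unfolding finitely_generated_def by blast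
  let ?S = "\<Union>i. along i ` S"
  have "\<exists>s\<in>span ?S. AE x in lebesgue_on \<Omega>. \<tau> x = s x" if "\<tau> \<in> vector_valued X" for \<tau>
  proof -
    have "\<exists>s\<in>span S. AE x in lebesgue_on \<Omega>. \<tau> x $ i = s x" for i
      using S(2) that by (simp add: vector_valued_def)
    then obtain s where s: "\<And>i. s i \<in> span S" "\<And>i. AE x in lebesgue_on \<Omega>. \<tau> x $ i = s i x"
      by metis
    have "(\<Sum>i\<in>UNIV. along i (s i)) \<in> span ?S"
    proof (rule span_sum)
      fix i
      have "along i (s i) \<in> span (along i ` S)" using linear_span_image[OF linear_along, of i S] s(1) by blast
      then show "along i (s i) \<in> span ?S" using span_mono[of "along i ` S" ?S] by blast
    qed
    moreover have "AE x in lebesgue_on \<Omega>. \<forall>i\<in>UNIV. \<tau> x $ i = s i x"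
      using s(2) by (intro AE_finite_allI) auto
    then have "AE x in lebesgue_on \<Omega>. \<tau> x = (\<Sum>i\<in>UNIV. along i (s i)) x"
      by eventually_elim (simp add: sum_fun_apply along_def vec_eq_iff axis_def if_distrib cong: if_cong)
    ultimately show ?thesis by blast
  qed
  moreover have "finite ?S" using S(1) by simp
  ultimately show ?thesis unfolding finitely_generated_def by blast
qed

lemma V_h_eq:
  "V_h \<Omega> K \<T> F k = H1_space \<Omega> \<inter> piecewise \<T> (\<lambda>T. (\<lambda>p x. p (inv (F T) x)) ` poly_space K k) \<inter> H10_space \<Omega>"
  by (auto simp: V_h_def S_h_def piecewise_def)

lemma L_h_eq:
  "L_h \<Omega> K \<T> k = L2_space \<Omega> \<inter> piecewise \<T> (\<lambda>T. (\<lambda>p x. p x) ` poly_space K k)"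
  by (auto simp: L_h_def piecewise_def)

context
  fixes \<Omega> :: "(real ^ 'n) set" and K \<T> F
  assumes \<Omega>: "open \<Omega>" "bounded \<Omega>" and part: "affine_partition \<Omega> K \<T> F"
begin

lemma finitely_generated_poly:
  "finitely_generated \<Omega> (piecewise \<T> (\<lambda>T. (\<lambda>p x. p (G T x)) ` poly_space K k))"
proof (rule finitely_generated_piecewise)
  show "finite \<T>" "disjoint \<T>" using part by (auto simp: affine_partition_def)
  show "\<Omega> \<subseteq> (\<Union>T\<in>\<T>. closure T)"
    using part closure_subset[of \<Omega>] unfolding affine_partition_def by blast
  show "\<Omega> \<in> sets lebesgue" using \<Omega>(1) by simp
qed (intro affine_partition_elements[OF part \<Omega>(2)] poly_space_comp_span; assumption)+

lemma V_h_subspace: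
  "subspace (V_h \<Omega> K \<T> F k)" "V_h \<Omega> K \<T> F k \<subseteq> H10_space \<Omega>" "finitely_generated \<Omega> (V_h \<Omega> K \<T> F k)"
proof -
  show "subspace (V_h \<Omega> K \<T> F k)" unfolding V_h_eq
    by (intro subspace_inter subspace_H1_space[OF \<Omega>] subspace_H10_space[OF \<Omega>] subspace_piecewise subspace_poly_space_comp)
  show "V_h \<Omega> K \<T> F k \<subseteq> H10_space \<Omega>" by (simp add: V_h_eq)
  show "finitely_generated \<Omega> (V_h \<Omega> K \<T> F k)"
    using finitely_generated_poly by (rule finitely_generated_mono) (auto simp: V_h_eq)
qed

lemma L_h_subspace:
  "subspace (L_h \<Omega> K \<T> k)" "L_h \<Omega> K \<T> k \<subseteq> L2_space \<Omega>" "finitely_generated \<Omega> (L_h \<Omega> K \<T> k)"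
proof -
  show "subspace (L_h \<Omega> K \<T> k)" unfolding L_h_eq
    by (intro subspace_inter subspace_L2_space subspace_piecewise subspace_poly_space_comp)
  show "L_h \<Omega> K \<T> k \<subseteq> L2_space \<Omega>" by (simp add: L_h_eq)
  show "finitely_generated \<Omega> (L_h \<Omega> K \<T> k)"
    using finitely_generated_poly[of "\<lambda>T x. x"] by (rule finitely_generated_mono) (auto simp: L_h_eq)
qed

end

subsection \<open>Galerkin approximation\<close>

text \<open>The infima are taken one after the other: with \<open>y\<close> fixed, the bound holds
  for all \<open>x\<close> and so for their infimum.\<close>

lemma le_mult_INF_add:
  fixes f :: "'a \<Rightarrow> real" and g :: "'b \<Rightarrow> real"
  assumes "A \<noteq> {}" "B \<noteq> {}" "c > 0" "\<And>x y. x \<in> A \<Longrightarrow> y \<in> B \<Longrightarrow> L \<le> c * (f x + g y)"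
  shows "L \<le> c * ((INF x\<in>A. f x) + (INF y\<in>B. g y))"
proof -
  have "L / c - g y \<le> (INF x\<in>A. f x)" if "y \<in> B" for y
    using assms(1,3) assms(4)[OF _ that] by (intro cINF_greatest) (auto simp: field_simps)
  then have "L / c - (INF x\<in>A. f x) \<le> (INF y\<in>B. g y)"
    using assms(2) by (intro cINF_greatest) (auto simp: algebra_simps)
  then show ?thesis using assms(3) by (simp add: field_simps)
qed

text \<open>Three properties of each of \<open>V\<close> and \<open>W\<close> suffice, so both
  choices of \<open>W\<close> are treated at once.\<close>

lemma galerkin:
  fixes \<Omega> :: "(real ^ 'n) set"
  assumes \<Omega>: "open \<Omega>" "bounded \<Omega>" and R: "\<And>x. x \<in> \<Omega> \<Longrightarrow> norm x \<le> R" "R > 0"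
    and ell: "ell \<in> H_minus1 \<Omega>" and u: "u \<in> H10_space \<Omega>"
    and min: "\<And>v. v \<in> H10_space \<Omega> \<Longrightarrow> energy \<Omega> ell u \<le> energy \<Omega> ell v"
    and \<sigma>: "has_weak_gradient \<Omega> u \<sigma>"
    and V: "subspace V" "V \<subseteq> H10_space \<Omega>" "finitely_generated \<Omega> V"
    and W: "subspace W" "W \<subseteq> L2_space \<Omega>" "finitely_generated \<Omega> W"
  shows "\<exists>u\<^sub>h \<sigma>\<^sub>h. discrete_solution \<Omega> ell V W u\<^sub>h \<sigma>\<^sub>h \<and>
       (\<forall>w \<eta>. discrete_solution \<Omega> ell V W w \<eta> \<longrightarrow>
          (AE x in lebesgue_on \<Omega>. w x = u\<^sub>h x \<and> \<eta> x = \<sigma>\<^sub>h x)) \<and>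
       norm_H1 \<Omega> (\<lambda>x. u x - u\<^sub>h x) + norm_L2 \<Omega> (\<lambda>x. \<sigma> x - \<sigma>\<^sub>h x)
         \<le> 4 * (R + 1) * ((INF v\<in>V. norm_H1 \<Omega> (\<lambda>x. u x - v x))
                + (INF \<tau>\<in>W. norm_L2 \<Omega> (\<lambda>x. \<sigma> x - \<tau> x)))"
proof -
  let ?E = "H10_space \<Omega> \<times> (L2_space \<Omega> :: (real ^ 'n \<Rightarrow> real ^ 'n) set)" and ?X = "V \<times> W"
  let ?B = "bilinear_a \<Omega>"
  interpret A: semi_inner ?E ?B by (rule semi_inner_bilinear_a[OF \<Omega>])
  have Poinc: "norm_L2 \<Omega> v \<le> 2 * R * grad_norm \<Omega> v" if "v \<in> H10_space \<Omega>" for v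
    by (rule Poincare[OF \<Omega> _ R(2) that]) (rule R(1))
  have \<sigma>L: "\<sigma> \<in> L2_space \<Omega>" using has_weak_gradient_L2[OF \<sigma>] .
  have z: "(u, \<sigma>) \<in> ?E" using u \<sigma>L by simp
  have X: "subspace ?X" "?X \<subseteq> ?E" using V W subspace_Times[OF V(1) W(1)] by auto
  have exact: "?B (u, \<sigma>) (v, \<tau>) = 2 * ell v" if "v \<in> V" "\<tau> \<in> W" for v \<tau>
    by (intro bilinear_a_exact[OF \<Omega>] Euler_Lagrange[OF \<Omega>] ell u min \<sigma>) (use that V W in auto)
  \<comment> \<open>Zero energy kills \<tau> and \<nabla>v, and Poincare then kills
    \<open>v\<close>; this is what uniqueness rests on.\<close>
  have zero: "(AE x in lebesgue_on \<Omega>. v x = 0) \<and> (AE x in lebesgue_on \<Omega>. \<tau> x = 0)"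
    if "v \<in> H10_space \<Omega>" "\<tau> \<in> L2_space \<Omega>" "?B (v, \<tau>) (v, \<tau>) = 0" for v \<tau>
  proof -
    have "norm_L2 \<Omega> \<tau> \<le> 0" "grad_norm \<Omega> v \<le> 0"
      using energy_norm_lower[OF \<Omega> that(1,2)] that(3) by simp_all
    then have "norm_L2 \<Omega> \<tau> = 0" "grad_norm \<Omega> v = 0"
      using grad_norm_nonneg[of \<Omega> v] norm_L2_nonneg[of \<Omega> \<tau>] by (auto intro: antisym)
    moreover from this have "norm_L2 \<Omega> v = 0"
      using Poinc[OF that(1)] norm_L2_nonneg[of \<Omega> v] by simp
    ultimately show ?thesis
      using norm_L2_eq_0_iff[OF that(2)] norm_L2_eq_0_iff[OF H1_spaceD(1)[OF H10_H1[OF that(1)]]]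
      by simp
  qed
  let ?Z = "{v :: real ^ 'n \<Rightarrow> real. AE x in lebesgue_on \<Omega>. v x = 0} \<times>
     {v :: real ^ 'n \<Rightarrow> real ^ 'n. AE x in lebesgue_on \<Omega>. v x = 0}"
  obtain S where S: "finite S" "?X \<subseteq> {s + n |s n. s \<in> span S \<and> n \<in> ?Z}"
    by (rule finitely_generated_Times[OF V(3) W(3)])
  \<comment> \<open>The converse, demanded by \<open>exists_projection\<close>: a function vanishing
    almost everywhere has weak gradient 0, hence the pair has no energy.\<close>
  have Z0: "?B x x = 0" if x: "x \<in> ?X" "x \<in> ?Z" for x
  proof -
    obtain v \<tau> where [simp]: "x = (v, \<tau>)" by (cases x)
    have m: "v \<in> H10_space \<Omega>" "\<tau> \<in> L2_space \<Omega>" using x V W by auto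
    have "AE x in lebesgue_on \<Omega>. v x = 0" "AE x in lebesgue_on \<Omega>. \<tau> x = 0" using x by auto
    moreover have "has_weak_gradient \<Omega> v 0"
    proof -
      have "(LINT x|lebesgue_on \<Omega>. v x * g x) = 0" for g
      proof -
        have "AE x in lebesgue_on \<Omega>. v x * g x = 0"
          using \<open>AE x in lebesgue_on \<Omega>. v x = 0\<close> by eventually_elim simp
        then show ?thesis by (rule integral_eq_zero_AE)
      qed
      then show ?thesis using L2.mem(4) by (simp add: has_weak_gradient_def)
    qed
    then have g: "AE x in lebesgue_on \<Omega>. weak_grad \<Omega> v x = 0 x"
      by (intro weak_grad_AE_eq[OF \<Omega>] H1_spaceD(1) H10_H1 m)
    ultimately have "norm_L2 \<Omega> \<tau> = 0" "grad_norm \<Omega> v = 0"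
      using norm_L2_eq_0_iff[OF m(2)] norm_L2_eq_0_iff[OF H1_spaceD(3)[OF H10_H1[OF m(1)]]]
      by (auto simp: grad_norm_def)
    then have "sqrt (?B x x) \<le> 0" using energy_norm_upper[OF \<Omega> m] by simp
    then show ?thesis using A.nonneg[of x] m by simp
  qed
  have "\<exists>p\<in>?X. \<forall>x\<in>?X. ?B ((u, \<sigma>) - p) x = 0"
    by (rule A.exists_projection[OF S(1) X subspace_Times[OF subspace_null subspace_null] Z0 S(2) z])
  then obtain p where p: "p \<in> ?X" "\<And>x. x \<in> ?X \<Longrightarrow> ?B ((u, \<sigma>) - p) x = 0" by blast
  obtain u\<^sub>h \<sigma>\<^sub>h where ph: "p = (u\<^sub>h, \<sigma>\<^sub>h)" by (cases p)
  have h: "u\<^sub>h \<in> V" "\<sigma>\<^sub>h \<in> W" using p(1) ph by auto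
  have pX: "(u\<^sub>h, \<sigma>\<^sub>h) \<in> ?X" using h by simp
  have sol: "?B (u\<^sub>h, \<sigma>\<^sub>h) (v, \<tau>) = 2 * ell v" if "v \<in> V" "\<tau> \<in> W" for v \<tau>
  proof -
    have "?B ((u, \<sigma>) - (u\<^sub>h, \<sigma>\<^sub>h)) (v, \<tau>) = 0" using p(2)[of "(v, \<tau>)"] that ph by blast
    moreover have E: "(u\<^sub>h, \<sigma>\<^sub>h) \<in> ?E" "(v, \<tau>) \<in> ?E" using X(2) that pX by blast+
    ultimately show ?thesis using exact[OF that] unfolding A.diff_left[OF z E] by simp
  qed
  have "discrete_solution \<Omega> ell V W u\<^sub>h \<sigma>\<^sub>h" using h sol unfolding discrete_solution_def by blast
  moreover have "AE x in lebesgue_on \<Omega>. w x = u\<^sub>h x \<and> \<eta> x = \<sigma>\<^sub>h x"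
    if "discrete_solution \<Omega> ell V W w \<eta>" for w \<eta>
  proof -
    have w: "w \<in> V" "\<eta> \<in> W" "\<And>v \<tau>. v \<in> V \<Longrightarrow> \<tau> \<in> W \<Longrightarrow> ?B (w, \<eta>) (v, \<tau>) = 2 * ell v"
      using that unfolding discrete_solution_def by blast+
    have d: "w - u\<^sub>h \<in> V" "\<eta> - \<sigma>\<^sub>h \<in> W" using subspace_diff V W w h by blast+
    have E: "(w, \<eta>) \<in> ?E" "(u\<^sub>h, \<sigma>\<^sub>h) \<in> ?E" "(w - u\<^sub>h, \<eta> - \<sigma>\<^sub>h) \<in> ?E" using V W w h d by blast+
    \<comment> \<open>The difference of two discrete solutions is itself an admissible test
      pair.\<close>
    have "?B ((w, \<eta>) - (u\<^sub>h, \<sigma>\<^sub>h)) (w - u\<^sub>h, \<eta> - \<sigma>\<^sub>h) = 0"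
      unfolding A.diff_left[OF E] using w(3)[OF d] sol[OF d] by simp
    then have "?B (w - u\<^sub>h, \<eta> - \<sigma>\<^sub>h) (w - u\<^sub>h, \<eta> - \<sigma>\<^sub>h) = 0" by (simp only: diff_Pair)
    then have "AE x in lebesgue_on \<Omega>. (w - u\<^sub>h) x = 0" "AE x in lebesgue_on \<Omega>. (\<eta> - \<sigma>\<^sub>h) x = 0"
      using zero[of "w - u\<^sub>h" "\<eta> - \<sigma>\<^sub>h"] E(3) by blast+
    then show ?thesis by eventually_elim simp
  qed
  moreover have "norm_H1 \<Omega> (\<lambda>x. u x - u\<^sub>h x) + norm_L2 \<Omega> (\<lambda>x. \<sigma> x - \<sigma>\<^sub>h x)
         \<le> 4 * (R + 1) * ((INF v\<in>V. norm_H1 \<Omega> (\<lambda>x. u x - v x))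
                + (INF \<tau>\<in>W. norm_L2 \<Omega> (\<lambda>x. \<sigma> x - \<tau> x)))"
  proof (rule le_mult_INF_add)
    show "V \<noteq> {}" "W \<noteq> {}" using h by auto
    show "0 < 4 * (R + 1)" using R(2) by simp
    fix v \<tau> assume v\<tau>: "v \<in> V" "\<tau> \<in> W"
    \<comment> \<open>The energy norm of the error, to be compared with both sides of the
      estimate.\<close>
    define q where "q = sqrt (?B (u - u\<^sub>h, \<sigma> - \<sigma>\<^sub>h) (u - u\<^sub>h, \<sigma> - \<sigma>\<^sub>h))"
    have e: "u - u\<^sub>h \<in> H10_space \<Omega>" "\<sigma> - \<sigma>\<^sub>h \<in> L2_space \<Omega>"
      and e': "u - v \<in> H10_space \<Omega>" "\<sigma> - \<tau> \<in> L2_space \<Omega>"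
      using h v\<tau> V W u \<sigma>L by (auto intro!: L2.mem subspace_diff[OF subspace_H10_space[OF \<Omega>]])
    have g: "grad_norm \<Omega> (u - u\<^sub>h) \<le> q" and s: "norm_L2 \<Omega> (\<sigma> - \<sigma>\<^sub>h) \<le> q"
      using energy_norm_lower[OF \<Omega> e] by (simp_all add: q_def)
    have "norm_H1 \<Omega> (u - u\<^sub>h) \<le> norm_L2 \<Omega> (u - u\<^sub>h) + grad_norm \<Omega> (u - u\<^sub>h)"
      by (rule norm_H1_le_sum)
    also have "\<dots> \<le> 2 * R * grad_norm \<Omega> (u - u\<^sub>h) + grad_norm \<Omega> (u - u\<^sub>h)"
      using Poinc[OF e(1)] by simp
    also have "\<dots> = (2 * R + 1) * grad_norm \<Omega> (u - u\<^sub>h)" by (simp add: algebra_simps)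
    also have "\<dots> \<le> (2 * R + 1) * q" using g R(2) by (intro mult_left_mono) simp_all
    \<comment> \<open>\<open>2 * R + 1\<close> from the H1 norm of the first error and 1 from the
      second.\<close>
    finally have 1: "norm_H1 \<Omega> (u - u\<^sub>h) + norm_L2 \<Omega> (\<sigma> - \<sigma>\<^sub>h) \<le> 2 * (R + 1) * q"
      using s by (simp add: algebra_simps)
    have "(v, \<tau>) \<in> ?X" using v\<tau> by simp
    from A.projection_best[OF z X pX p(2)[unfolded ph] this]
    have "q \<le> sqrt (?B (u - v, \<sigma> - \<tau>) (u - v, \<sigma> - \<tau>))"
      unfolding q_def by (simp only: diff_Pair real_sqrt_le_iff)
    also have "\<dots> \<le> 2 * (norm_L2 \<Omega> (\<sigma> - \<tau>) + grad_norm \<Omega> (u - v))"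
      by (rule energy_norm_upper[OF \<Omega> e'])
    also have "\<dots> \<le> 2 * (norm_H1 \<Omega> (u - v) + norm_L2 \<Omega> (\<sigma> - \<tau>))"
      unfolding add.commute[of "norm_L2 \<Omega> (\<sigma> - \<tau>)"]
      by (intro mult_left_mono add_right_mono grad_norm_le_norm_H1) simp
    \<comment> \<open>The inner factor 2 stems from \<open>energy_norm_upper\<close> and completes
      \<open>4 * (R + 1)\<close>.\<close>
    finally have 2: "2 * (R + 1) * q \<le> 2 * (R + 1) * (2 * (norm_H1 \<Omega> (u - v) + norm_L2 \<Omega> (\<sigma> - \<tau>)))"
      using R(2) by (intro mult_left_mono) simp_all
    have four: "4 * (R + 1) * x = 2 * (R + 1) * (2 * x)" for x by simp
    from order_trans[OF 1 2] have "norm_H1 \<Omega> (u - u\<^sub>h) + norm_L2 \<Omega> (\<sigma> - \<sigma>\<^sub>h)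
        \<le> 4 * (R + 1) * (norm_H1 \<Omega> (u - v) + norm_L2 \<Omega> (\<sigma> - \<tau>))"
      unfolding four .
    then show "norm_H1 \<Omega> (\<lambda>x. u x - u\<^sub>h x) + norm_L2 \<Omega> (\<lambda>x. \<sigma> x - \<sigma>\<^sub>h x)
        \<le> 4 * (R + 1) * (norm_H1 \<Omega> (\<lambda>x. u x - v x) + norm_L2 \<Omega> (\<lambda>x. \<sigma> x - \<tau> x))"
      by (simp only: fun_diff_def)
  qed
  ultimately show ?thesis by blast
qed

theorem theorem1:
  fixes \<Omega> :: "(real ^ 'n) set" and k :: nat
  assumes "CARD('n) \<in> {2, 3}"
    and "polyhedral_convex_domain \<Omega>"
  shows "\<exists>c>0. \<forall>ell u \<sigma> K \<T> F \<rho> V W.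
    ell \<in> H_minus1 \<Omega> \<longrightarrow>
    u \<in> H10_space \<Omega> \<longrightarrow> (\<forall>v\<in>H10_space \<Omega>. energy \<Omega> ell u \<le> energy \<Omega> ell v) \<longrightarrow>
    has_weak_gradient \<Omega> u \<sigma> \<longrightarrow>
    affine_partition \<Omega> K \<T> F \<longrightarrow> quasi_uniform \<rho> \<T> \<longrightarrow>
    V = V_h \<Omega> K \<T> F k \<longrightarrow>
    (W = vector_valued (L_h \<Omega> K \<T> k) \<or> W = vector_valued V) \<longrightarrow>
    (\<exists>u\<^sub>h \<sigma>\<^sub>h. discrete_solution \<Omega> ell V W u\<^sub>h \<sigma>\<^sub>h \<and>
       (\<forall>w \<eta>. discrete_solution \<Omega> ell V W w \<eta> \<longrightarrow>
          (AE x in lebesgue_on \<Omega>. w x = u\<^sub>h x \<and> \<eta> x = \<sigma>\<^sub>h x)) \<and>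
       norm_H1 \<Omega> (\<lambda>x. u x - u\<^sub>h x) + norm_L2 \<Omega> (\<lambda>x. \<sigma> x - \<sigma>\<^sub>h x)
         \<le> c * ((INF v\<in>V. norm_H1 \<Omega> (\<lambda>x. u x - v x))
                + (INF \<tau>\<in>W. norm_L2 \<Omega> (\<lambda>x. \<sigma> x - \<tau> x))))"
proof -
  have \<Omega>: "open \<Omega>" "bounded \<Omega>" using assms(2) by (auto simp: polyhedral_convex_domain_def)
  \<comment> \<open>\<open>R\<close> is fixed before the data and the partition are introduced, so
    the constant cannot depend on them.\<close>
  obtain R where R: "R > 0" "\<And>x. x \<in> \<Omega> \<Longrightarrow> norm x \<le> R"
    using \<Omega>(2) unfolding bounded_pos by blast
  show ?thesis
  proof (rule exI[of _ "4 * (R + 1)"], intro conjI allI impI, goal_cases)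
    case 1
    then show ?case using R(1) by simp
  next
    case (2 ell u \<sigma> K \<T> F \<rho> V W)
    note V = V_h_subspace[OF \<Omega> 2(5), of k, folded 2(7)] and L = L_h_subspace[OF \<Omega> 2(5), of k]
    have "V \<subseteq> L2_space \<Omega>" using V(2) H1_spaceD(1) H10_H1 by blast
    \<comment> \<open>Both admissible \<open>W\<close> have the form \<open>vector_valued Y\<close>,
      with \<open>Y\<close> either \<open>L_h\<close> or \<open>V\<close> itself.\<close>
    then obtain Y where Y: "W = vector_valued Y" "subspace Y" "Y \<subseteq> L2_space \<Omega>" "finitely_generated \<Omega> Y"
      using 2(8) V(1,3) L by blast
    note W = subspace_vector_valued[OF Y(2), folded Y(1)] vector_valued_L2[OF Y(3), folded Y(1)]
      finitely_generated_vector_valued[OF Y(4), folded Y(1)]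
    show ?case
      by (rule galerkin[OF \<Omega> R(2) R(1) 2(1,2) _ 2(4) V W]) (use 2(3) in auto)
  qed
qed

end
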